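(* Let $K,M\ge 2$. One can build a (finite, bottom-up) tree automaton $\mathcal{A}^{K,M}_{\mathsf{valid}}$ with $M^{O(K)}$ states whose language is exactly the set of monotonic $(K,M)$-STTs $\tau$ such that the graph $[\![\tau]\!]$ is a realizable TCW and the endpoints of $[\![\tau]\!]$ are the only colored points.
   Context: Fix a finite alphabet $\Sigma$, $\Sigma_\varepsilon=\Sigma\cup\{\varepsilon\}$. Let $\mathcal{I}(M)$ be the finite set of closed intervals $[c,d]$ with $c\in\{0,\dots,M-1\}$, $d\in\{0,\dots,M-1\}\cup\{\infty\}$. **Special tree terms.** A $(K,M)$-STT is a term of the grammar $$\tau ::= (i,a)\mid \mathsf{Add}^{\to}_{i,j}\,\tau\mid \mathsf{Add}^{\curvearrowright I}_{i,j}\,\tau\mid\mathsf{Forget}_i\,\tau\mid\mathsf{Rename}_{i,j}\,\tau\mid\tau\oplus\tau$$ with $a\in\Sigma_\varepsilon$, $I\in\mathcal{I}(M)$ and colors $i,j\in\{1,\dots,K\}$; terms are viewed as labelled trees of arity at most 2. The semantics is a colored graph $[\![\tau]\!]=(G_\tau,\chi_\tau)$ with $G_\tau=(V,\to,(\curvearrowright^I)_{I\in\mathcal{I}(M)},\lambda)$, $\lambda:V\to\Sigma_\varepsilon$, and $\chi_\tau$ a partial injective map from $\{1,\dots,K\}$ to $V$: $(i,a)$ is a single $a$-labelled vertex colored $i$; $\mathsf{Add}^{\to}_{i,j}$ (resp. $\mathsf{Add}^{\curvearrowright I}_{i,j}$) adds a $\to$-edge (resp. a $\curvearrowright^I$-edge)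 from the vertex colored $i$ to the vertex colored $j$ (if both exist); $\mathsf{Forget}_i$ removes color $i$ from the domain of the coloring; $\mathsf{Rename}_{i,j}$ exchanges colors $i$ and $j$; $\oplus$ is disjoint union, defined only if the two arguments have disjoint sets of active colors (domains of the colorings). **Monotonic.** For $P\subseteq\{1,\dots,K\}$ and $i\in P$ let $\mathrm{next}_P(i)=\min\{j\in P\cup\{\infty\}\mid i<j\}$ and $\mathrm{prev}_P(i)=\max\{j\in P\cup\{0\}\mid j<i\}$. A term is monotonic if for every subterm $\mathsf{Add}^{\to}_{i,j}\tau'$ (resp. $\mathsf{Add}^{\curvearrowright I}_{i,j}\tau'$, resp. $\mathsf{Rename}_{i,j}\tau'$), with $P$ the set of active colors of $\tau'$, one has $j=\mathrm{next}_P(i)$ (resp. $i<j$, resp. $\mathrm{prev}_P(i)<j<\mathrm{next}_P(i)$). **TCW.** $G_\tau$ is a word with timing constraints (TCW) if $\leq\;=\;\to^*$ is a total order on $V$ whose direct-successor relation is $\to$, and $\curvearrowright^I\subseteq{<}$ for all $I$. Its endpoints are the minimal and maximal vertices. It is realizable if there is a map $t:V\to\mathbb{R}$, non-decreasing with respect to $\le$, with $t(v)-t(u)\in I$ for all $u\curvearrowright^Iv$. "The endpoints are the only colored points" means the image of $\chi_\tau$ is exactly the set of endpoints. *)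

theory Defs
  imports Complex_Main "HOL-Library.Extended_Nat"
begin

text \<open>The letter \<open>None\<close> of type \<open>'a option\<close> stands for \<open>\<epsilon>\<close>. A pair of endpoints
  \<open>c, d\<close> with \<open>d < c\<close> is not excluded: it yields the empty set.\<close>

definition intervals :: "nat \<Rightarrow> real set set" where
  "intervals M = {{real c..real d} | c d. c < M \<and> d < M} \<union> {{real c..} | c. c < M}"

datatype 'a stt =
    Leaf nat "'a option"
  | AddSucc nat nat "'a stt"
  | AddTime "real set" nat nat "'a stt"
  | Forget nat "'a stt"
  | Rename nat nat "'a stt"
  | Oplus "'a stt" "'a stt"

primrec is_stt :: "nat \<Rightarrow> nat \<Rightarrow> 'a stt \<Rightarrow> bool" where
  "is_stt K M (Leaf i a) \<longleftrightarrow> i \<in> {1..K}"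
| "is_stt K M (AddSucc i j \<tau>) \<longleftrightarrow> i \<in> {1..K} \<and> j \<in> {1..K} \<and> is_stt K M \<tau>"
| "is_stt K M (AddTime I i j \<tau>) \<longleftrightarrow>
     I \<in> intervals M \<and> i \<in> {1..K} \<and> j \<in> {1..K} \<and> is_stt K M \<tau>"
| "is_stt K M (Forget i \<tau>) \<longleftrightarrow> i \<in> {1..K} \<and> is_stt K M \<tau>"
| "is_stt K M (Rename i j \<tau>) \<longleftrightarrow> i \<in> {1..K} \<and> j \<in> {1..K} \<and> is_stt K M \<tau>"
| "is_stt K M (Oplus \<tau>1 \<tau>2) \<longleftrightarrow> is_stt K M \<tau>1 \<and> is_stt K M \<tau>2"


text \<open>A vertex is the address of its leaf among the occurrences of \<open>Oplus\<close> (\<open>False\<close> for the left,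
  \<open>True\<close> for the right argument), so that disjoint unions can be formed within one type.
  The labelling is only meaningful on \<open>verts\<close>.\<close>

type_synonym vertex = "bool list"

record 'a cgraph =
  verts :: "vertex set"
  succs :: "(vertex \<times> vertex) set"
  timed :: "real set \<Rightarrow> (vertex \<times> vertex) set"
  lab :: "vertex \<Rightarrow> 'a option"
  col :: "nat \<rightharpoonup> vertex"

definition leaf_graph :: "nat \<Rightarrow> 'a option \<Rightarrow> 'a cgraph" where
  "leaf_graph i a =
     \<lparr>verts = {[]}, succs = {}, timed = (\<lambda>I. {}), lab = (\<lambda>v. a), col = [i \<mapsto> []]\<rparr>"

definition colored_pair :: "'a cgraph \<Rightarrow> nat \<Rightarrow> nat \<Rightarrow> (vertex \<times> vertex) set" where
  "colored_pair G i j = {(u, v). col G i = Some u \<and> col G j = Some v}"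

definition add_succ :: "nat \<Rightarrow> nat \<Rightarrow> 'a cgraph \<Rightarrow> 'a cgraph" where
  "add_succ i j G = G\<lparr>succs := succs G \<union> colored_pair G i j\<rparr>"

definition add_time :: "real set \<Rightarrow> nat \<Rightarrow> nat \<Rightarrow> 'a cgraph \<Rightarrow> 'a cgraph" where
  "add_time I i j G = G\<lparr>timed := (timed G)(I := timed G I \<union> colored_pair G i j)\<rparr>"

definition forget :: "nat \<Rightarrow> 'a cgraph \<Rightarrow> 'a cgraph" where
  "forget i G = G\<lparr>col := (col G)(i := None)\<rparr>"

definition rename :: "nat \<Rightarrow> nat \<Rightarrow> 'a cgraph \<Rightarrow> 'a cgraph" where
  "rename i j G = G\<lparr>col := (col G)(i := col G j, j := col G i)\<rparr>"

definition graph_union :: "'a cgraph \<Rightarrow> 'a cgraph \<Rightarrow> 'a cgraph" where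
  "graph_union G H =
     (let l = Cons False; r = Cons True in
      \<lparr>verts = l ` verts G \<union> r ` verts H,
       succs = map_prod l l ` succs G \<union> map_prod r r ` succs H,
       timed = (\<lambda>I. map_prod l l ` timed G I \<union> map_prod r r ` timed H I),
       lab = (\<lambda>v. if hd v then lab H (tl v) else lab G (tl v)),
       col = (\<lambda>k. map_option l (col G k)) ++ (\<lambda>k. map_option r (col H k))\<rparr>)"

text \<open>\<open>None\<close> means that the semantics is undefined.\<close>

primrec sem :: "'a stt \<Rightarrow> 'a cgraph option" where
  "sem (Leaf i a) = Some (leaf_graph i a)"
| "sem (AddSucc i j \<tau>) = map_option (add_succ i j) (sem \<tau>)"
| "sem (AddTime I i j \<tau>) = map_option (add_time I i j) (sem \<tau>)"
| "sem (Forget i \<tau>) = map_option (forget i) (sem \<tau>)"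
| "sem (Rename i j \<tau>) = map_option (rename i j) (sem \<tau>)"
| "sem (Oplus \<tau>1 \<tau>2) =
     (case (sem \<tau>1, sem \<tau>2) of
        (Some G, Some H) \<Rightarrow>
          if dom (col G) \<inter> dom (col H) = {} then Some (graph_union G H) else None
      | _ \<Rightarrow> None)"


definition next_color :: "nat set \<Rightarrow> nat \<Rightarrow> enat" where
  "next_color P i = Min {j \<in> enat ` P \<union> {\<infinity>}. enat i < j}"

definition prev_color :: "nat set \<Rightarrow> nat \<Rightarrow> nat" where
  "prev_color P i = Max {j \<in> P \<union> {0}. j < i}"

definition active :: "'a stt \<Rightarrow> nat set" where
  "active \<tau> = (case sem \<tau> of None \<Rightarrow> {} | Some G \<Rightarrow> dom (col G))"

text \<open>The functions \<open>next_P\<close> and \<open>prev_P\<close> are only defined on \<open>P\<close>; hence the conditions on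
  \<open>AddSucc\<close> and \<open>Rename\<close> require the color \<open>i\<close> to be active.\<close>

primrec monotonic :: "'a stt \<Rightarrow> bool" where
  "monotonic (Leaf i a) \<longleftrightarrow> True"
| "monotonic (AddSucc i j \<tau>) \<longleftrightarrow>
     i \<in> active \<tau> \<and> enat j = next_color (active \<tau>) i \<and> monotonic \<tau>"
| "monotonic (AddTime I i j \<tau>) \<longleftrightarrow> i < j \<and> monotonic \<tau>"
| "monotonic (Forget i \<tau>) \<longleftrightarrow> monotonic \<tau>"
| "monotonic (Rename i j \<tau>) \<longleftrightarrow>
     i \<in> active \<tau> \<and> prev_color (active \<tau>) i < j \<and> enat j < next_color (active \<tau>) i \<and> monotonic \<tau>"
| "monotonic (Oplus \<tau>1 \<tau>2) \<longleftrightarrow> monotonic \<tau>1 \<and> monotonic \<tau>2"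


definition le_rel :: "'a cgraph \<Rightarrow> (vertex \<times> vertex) set" where
  "le_rel G = (succs G)\<^sup>* \<inter> verts G \<times> verts G"

definition less_rel :: "'a cgraph \<Rightarrow> (vertex \<times> vertex) set" where
  "less_rel G = le_rel G - Id"

definition is_tcw :: "'a cgraph \<Rightarrow> bool" where
  "is_tcw G \<longleftrightarrow>
     linear_order_on (verts G) (le_rel G) \<and>
     succs G = {(u, v) \<in> less_rel G. \<not> (\<exists>w. (u, w) \<in> less_rel G \<and> (w, v) \<in> less_rel G)} \<and>
     (\<forall>I. timed G I \<subseteq> less_rel G)"

definition endpoints :: "'a cgraph \<Rightarrow> vertex set" where
  "endpoints G =
     {v \<in> verts G. \<not> (\<exists>u. (u, v) \<in> less_rel G)} \<union> {v \<in> verts G. \<not> (\<exists>u. (v, u) \<in> less_rel G)}"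

definition realizable :: "'a cgraph \<Rightarrow> bool" where
  "realizable G \<longleftrightarrow>
     (\<exists>t :: vertex \<Rightarrow> real.
        (\<forall>(u, v) \<in> le_rel G. t u \<le> t v) \<and>
        (\<forall>I. \<forall>(u, v) \<in> timed G I. t v - t u \<in> I))"


datatype 'f ltree = Node 'f "'f ltree list"

record ('f, 'q) nta =
  states :: "'q set"
  final :: "'q set"
  rules :: "('f \<times> 'q list \<times> 'q) set"

text \<open>Nondeterministic finite bottom-up tree automata over the ranked alphabet \<open>(F, rk)\<close>.\<close>

definition tree_automaton :: "'f set \<Rightarrow> ('f \<Rightarrow> nat) \<Rightarrow> ('f, 'q) nta \<Rightarrow> bool" where
  "tree_automaton F rk A \<longleftrightarrow>
     finite F \<and> finite (states A) \<and> final A \<subseteq> states A \<and>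
     (\<forall>(f, qs, q) \<in> rules A.
        f \<in> F \<and> length qs = rk f \<and> set qs \<subseteq> states A \<and> q \<in> states A)"

inductive reaches :: "('f, 'q) nta \<Rightarrow> 'f ltree \<Rightarrow> 'q \<Rightarrow> bool" for A where
  "(f, qs, q) \<in> rules A \<Longrightarrow> list_all2 (reaches A) ts qs \<Longrightarrow> reaches A (Node f ts) q"

definition lang :: "('f, 'q) nta \<Rightarrow> 'f ltree set" where
  "lang A = {t. \<exists>q \<in> final A. reaches A t q}"


datatype 'a stt_op =
    LeafOp nat "'a option"
  | AddSuccOp nat nat
  | AddTimeOp "real set" nat nat
  | ForgetOp nat
  | RenameOp nat nat
  | OplusOp

primrec op_rank :: "'a stt_op \<Rightarrow> nat" where
  "op_rank (LeafOp i a) = 0"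
| "op_rank (AddSuccOp i j) = 1"
| "op_rank (AddTimeOp I i j) = 1"
| "op_rank (ForgetOp i) = 1"
| "op_rank (RenameOp i j) = 1"
| "op_rank OplusOp = 2"

definition stt_ops :: "nat \<Rightarrow> nat \<Rightarrow> 'a stt_op set" where
  "stt_ops K M =
     {LeafOp i a | i a. i \<in> {1..K}} \<union>
     {AddSuccOp i j | i j. i \<in> {1..K} \<and> j \<in> {1..K}} \<union>
     {AddTimeOp I i j | I i j. I \<in> intervals M \<and> i \<in> {1..K} \<and> j \<in> {1..K}} \<union>
     {ForgetOp i | i. i \<in> {1..K}} \<union>
     {RenameOp i j | i j. i \<in> {1..K} \<and> j \<in> {1..K}} \<union>
     {OplusOp}"

primrec tree_of :: "'a stt \<Rightarrow> 'a stt_op ltree" where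
  "tree_of (Leaf i a) = Node (LeafOp i a) []"
| "tree_of (AddSucc i j \<tau>) = Node (AddSuccOp i j) [tree_of \<tau>]"
| "tree_of (AddTime I i j \<tau>) = Node (AddTimeOp I i j) [tree_of \<tau>]"
| "tree_of (Forget i \<tau>) = Node (ForgetOp i) [tree_of \<tau>]"
| "tree_of (Rename i j \<tau>) = Node (RenameOp i j) [tree_of \<tau>]"
| "tree_of (Oplus \<tau>1 \<tau>2) = Node OplusOp [tree_of \<tau>1, tree_of \<tau>2]"

end

theory Submission imports Defs "HOL-Library.FuncSet" begin

text \<open>The points of a subterm of an accepted term inherit a linear order and time stamps from the
  final word; since all constants are integers, the stamps can be rounded down to integers. In this
  order the colored points appear in the order of their colors, every uncolored point already has
  both its neighbours, and the gaps between blocks of consecutive points therefore lie between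
  colored points. So all that matters about the past is, for each color, whether its point has a
  predecessor, a successor, and a successor that is itself colored, its stamp modulo \<open>M\<close>,
  and whether the distance to the next colored point is at least \<open>M\<close>. The automaton guesses
  these data. Conversely, a run determines a layout: two layouts joined by \<open>Oplus\<close> are
  interleaved along their colors, and their stamps are reconciled by resizing gaps of width at least
  \<open>M\<close>, which no upper bound crosses because all upper bounds are smaller than \<open>M\<close>.\<close>

section \<open>Distances modulo \<open>M\<close>\<close>

text \<open>The rules speak about representatives: \<open>stt_rule\<close> ranges over all sets and
  stamps with a given \<open>summary\<close>, so the stamps used by a rule need not be those of the
  graph at hand. The relation \<open>sim\<close> bridges the difference. Residues and the flag for
  distance at least \<open>M\<close> determine distances between consecutive active colors up to
  \<open>sim\<close>, and \<open>sim\<close> is closed under addition; so data about neighbouring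
  colors control every pair of active colors, and membership in the intervals with it. The obstacle
  is \<open>Oplus\<close>. Its rule uses one common \<open>s\<close> for both arguments, but each
  argument has a layout of its own, whose stamps match \<open>s\<close> only up to
  \<open>sim\<close>. One cannot simply move the colored points to \<open>s\<close>: a distance of
  at least \<open>M\<close> between two colors of one block may consist of short steps between
  forgotten points, and these steps can carry upper bounds that the state no longer shows. Hence
  distances inside blocks are kept exactly and only those between blocks follow \<open>s\<close>;
  for this to be possible, no color of the other argument may fall inside a block. The flag for an
  edge to a colored point exists because a term may add the same edge twice, which leaves the graph
  unchanged and must be accepted.\<close>

definition adjacent :: "('b \<Rightarrow> nat) \<Rightarrow> 'b set \<Rightarrow> 'b \<Rightarrow> 'b \<Rightarrow> bool" where
  "adjacent f S u v \<longleftrightarrow> u \<in> S \<and> v \<in> S \<and> f u < f v \<and> \<not> (\<exists>w \<in> S. f u < f w \<and> f w < f v)"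

text \<open>A pair that is not adjacent splits at an intermediate point into two pairs with smaller
  differences. With \<open>f = id\<close> this serves for active colors and similarity of distances,
  with \<open>f = pos\<close> for vertices and reachability.\<close>

lemma adjacent_chain:
  assumes adj: "\<And>u v. adjacent f S u v \<Longrightarrow> Q u v"
    and trans: "\<And>u v w. \<lbrakk>u \<in> S; v \<in> S; w \<in> S; Q u v; Q v w\<rbrakk> \<Longrightarrow> Q u w"
  shows "\<lbrakk>u \<in> S; v \<in> S; f u < f v\<rbrakk> \<Longrightarrow> Q u v"
proof (induction "f v - f u" arbitrary: u v rule: less_induct)
  case less
  show ?case
  proof (cases "adjacent f S u v")
    case False
    then obtain w where w: "w \<in> S" "f u < f w" "f w < f v"
      using less.prems by (auto simp: adjacent_def)
    then have "Q u w" "Q w v" using less by auto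
    then show ?thesis using trans less.prems w by blast
  qed (rule adj)
qed

lemma adjacent_next:
  assumes "u \<in> S" "v \<in> S" "f u < f v"
  obtains w where "adjacent f S u w" "f w \<le> f v"
proof -
  define w where "w = arg_min f (\<lambda>w. w \<in> S \<and> f u < f w)"
  have *: "w \<in> S \<and> f u < f w" unfolding w_def by (rule arg_min_natI) (use assms in blast)
  have le: "f w \<le> f x" if "x \<in> S" "f u < f x" for x
    unfolding w_def by (rule arg_min_nat_le) (use that in blast)
  have "adjacent f S u w" using * le assms(1) by (force simp: adjacent_def)
  then show ?thesis using that le assms by blast
qed

lemma adjacent_prev:
  assumes "u \<in> S" "v \<in> S" "f u < f v"
  obtains w where "adjacent f S w v" "f u \<le> f w"
proof -
  define Q where "Q n \<longleftrightarrow> (\<exists>w \<in> S. f w = n \<and> n < f v)" for n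
  have Q: "Q (f u)" using assms by (auto simp: Q_def)
  have bnd: "\<And>n. Q n \<Longrightarrow> n \<le> f v" by (auto simp: Q_def)
  have "Q (Greatest Q)" by (rule GreatestI_nat[of Q, OF Q bnd])
  then obtain w where w: "w \<in> S" "f w = Greatest Q" "f w < f v" by (auto simp: Q_def)
  have le: "f x \<le> f w" if "x \<in> S" "f x < f v" for x
    unfolding w(2) by (rule Greatest_le_nat[where P = Q, OF _ bnd]) (use that in \<open>auto simp: Q_def\<close>)
  have "adjacent f S w v" using w le assms(2) by (force simp: adjacent_def)
  then show ?thesis using that le assms by blast
qed

lemma adjacent_unique:
  assumes "inj_on f S"
  shows "adjacent f S u v \<Longrightarrow> adjacent f S u w \<Longrightarrow> v = w"
    and "adjacent f S v u \<Longrightarrow> adjacent f S w u \<Longrightarrow> v = w"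
  using assms unfolding adjacent_def by (metis inj_onD linorder_neqE_nat)+

text \<open>Two distances are similar if no interval of \<open>intervals M\<close> and no residue modulo \<open>M\<close>
  tells them apart.\<close>

definition sim :: "nat \<Rightarrow> int \<Rightarrow> int \<Rightarrow> bool" where
  "sim M a b \<longleftrightarrow> 0 \<le> a \<and> 0 \<le> b \<and> a mod int M = b mod int M \<and> (a < int M \<longleftrightarrow> b < int M)"

lemma sim_refl: "0 \<le> a \<Longrightarrow> sim M a a"
  by (simp add: sim_def)

lemma sim_sym: "sim M a b \<Longrightarrow> sim M b a"
  by (simp add: sim_def)

lemma sim_trans: "sim M a b \<Longrightarrow> sim M b c \<Longrightarrow> sim M a c"
  by (simp add: sim_def)

text \<open>Two numbers in the range from 0 to \<open>M - 1\<close> with the same residue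
  coincide.\<close>

lemma sim_cases:
  assumes "sim M a b"
  obtains "a = b" | "int M \<le> a" "int M \<le> b"
  using assms unfolding sim_def by (metis linorder_not_le mod_pos_pos_trivial)

text \<open>Nonnegativity decides: if one summand is at least \<open>M\<close> on both sides, then
  so are both sums; otherwise the summands agree pairwise.\<close>

lemma sim_add:
  assumes "sim M a b" "sim M a' b'"
  shows "sim M (a + a') (b + b')"
proof -
  have "(a + a') mod int M = (b + b') mod int M"
    using assms by (auto simp: sim_def intro: mod_add_cong)
  then show ?thesis
    using sim_cases[OF assms(1)] sim_cases[OF assms(2)] assms unfolding sim_def by smt
qed

text \<open>All finite bounds are smaller than \<open>M\<close>, so an interval contains either
  every number from \<open>M\<close> on or none.\<close>

lemma interval_sim:
  assumes "I \<in> intervals M" "a = b \<or> int M \<le> a \<and> int M \<le> b" "real_of_int a \<in> I"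
  shows "real_of_int b \<in> I"
proof (cases "a = b")
  case False
  then have ab: "int M \<le> a" "int M \<le> b" using assms by auto
  then have "real M \<le> real_of_int a" "real M \<le> real_of_int b" by linarith+
  then show ?thesis using assms(1,3) by (force simp: intervals_def)
qed (use assms in simp)

type_synonym state = "nat \<Rightarrow> ((bool \<times> bool \<times> bool) \<times> nat \<times> bool) option"

text \<open>\<open>P\<close> is the set of active colors, \<open>X\<close>, \<open>Y\<close> and \<open>Z\<close> are the sets of colors whose point has
  an outgoing edge, an incoming edge and an edge to a colored point, and \<open>s\<close> gives the time stamps.
  For monotone \<open>s\<close> the last component only depends on the next color in \<open>P\<close>.\<close>

definition summary ::
  "nat \<Rightarrow> nat set \<Rightarrow> nat set \<Rightarrow> nat set \<Rightarrow> nat set \<Rightarrow> (nat \<Rightarrow> int) \<Rightarrow> state" where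
  "summary M P X Y Z s =
     (\<lambda>i. if i \<in> P then
        Some ((i \<in> X, i \<in> Y, i \<in> Z), nat (s i mod int M), \<forall>j\<in>P. i < j \<longrightarrow> int M \<le> s j - s i)
      else None)"

lemma dom_summary [simp]: "dom (summary M P X Y Z s) = P"
  by (auto simp: summary_def dom_def)

text \<open>The flag sets are recovered only on \<open>P\<close> and the stamps only as residues;
  \<open>0 < M\<close> makes the residues nonnegative, so that \<open>nat\<close> loses
  nothing.\<close>

lemma summary_eqD:
  assumes "summary M P X Y Z s = summary M P' X' Y' Z' s'" "0 < M"
  shows "P = P'" "\<And>i. i \<in> P \<Longrightarrow> i \<in> X \<longleftrightarrow> i \<in> X'" "\<And>i. i \<in> P \<Longrightarrow> i \<in> Y \<longleftrightarrow> i \<in> Y'"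
    "\<And>i. i \<in> P \<Longrightarrow> i \<in> Z \<longleftrightarrow> i \<in> Z'" "\<And>i. i \<in> P \<Longrightarrow> s i mod int M = s' i mod int M"
proof -
  show P: "P = P'" using arg_cong[OF assms(1), of dom] by simp
  fix i assume i: "i \<in> P"
  have "summary M P X Y Z s i = summary M P' X' Y' Z' s' i" using assms(1) by simp
  then show "i \<in> X \<longleftrightarrow> i \<in> X'" "i \<in> Y \<longleftrightarrow> i \<in> Y'" "i \<in> Z \<longleftrightarrow> i \<in> Z'" "s i mod int M = s' i mod int M"
    using i P \<open>0 < M\<close> by (simp_all add: summary_def eq_nat_nat_iff)
qed

text \<open>For consecutive colors the residues and the last component give similarity at once;
  \<open>sim_add\<close> extends it along the chain of colors. This is why a state need not store
  distances between arbitrary pairs of colors.\<close>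

lemma summary_eq_sim:
  assumes eq: "summary M P X Y Z s = summary M P X' Y' Z' s'" and M: "0 < M"
    and mono: "mono_on P s" "mono_on P s'" and ij: "i \<in> P" "j \<in> P" "i < j"
  shows "sim M (s j - s i) (s' j - s' i)"
proof (rule adjacent_chain[where f = id and S = P and Q = "\<lambda>i j. sim M (s j - s i) (s' j - s' i)"])
  show "sim M (s v - s u) (s' v - s' u)" if "adjacent id P u v" for u v
  proof -
    have uv: "u \<in> P" "v \<in> P" "u < v" and nxt: "\<And>w. w \<in> P \<Longrightarrow> u < w \<Longrightarrow> v \<le> w"
      using that by (auto simp: adjacent_def not_less)
    have "(\<forall>j\<in>P. u < j \<longrightarrow> int M \<le> r j - r u) \<longleftrightarrow> int M \<le> r v - r u" if "mono_on P r" for r ::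
      "nat \<Rightarrow> int"
      using uv nxt monotone_onD[OF that] by force
    moreover have "(\<forall>j\<in>P. u < j \<longrightarrow> int M \<le> s j - s u) \<longleftrightarrow> (\<forall>j\<in>P. u < j \<longrightarrow> int M \<le> s' j - s' u)"
      using fun_cong[OF eq, of u] uv by (simp add: summary_def)
    ultimately have "int M \<le> s v - s u \<longleftrightarrow> int M \<le> s' v - s' u" using mono by metis
    moreover have "s v mod int M = s' v mod int M" "s u mod int M = s' u mod int M"
      using summary_eqD(5)[OF eq M] uv by auto
    then have "(s v - s u) mod int M = (s' v - s' u) mod int M" by (rule mod_diff_cong)
    ultimately show ?thesis
      using monotone_onD[OF mono(1), of u v] monotone_onD[OF mono(2), of u v] uv
      by (auto simp: sim_def)
  qed
  show "sim M (s w - s u) (s' w - s' u)"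
    if "u \<in> P" "v \<in> P" "w \<in> P" "sim M (s v - s u) (s' v - s' u)" "sim M (s w - s v) (s' w - s' v)"
    for u v w
    using sim_add[OF that(4,5)] by simp
qed (use ij in auto)

lemma summary_cong:
  assumes "\<And>i. i \<in> P \<Longrightarrow> i \<in> X \<longleftrightarrow> i \<in> X'" "\<And>i. i \<in> P \<Longrightarrow> i \<in> Y \<longleftrightarrow> i \<in> Y'"
    "\<And>i. i \<in> P \<Longrightarrow> i \<in> Z \<longleftrightarrow> i \<in> Z'" "\<And>i. i \<in> P \<Longrightarrow> s i mod int M = s' i mod int M"
    "\<And>i j. i \<in> P \<Longrightarrow> j \<in> P \<Longrightarrow> i < j \<Longrightarrow> sim M (s j - s i) (s' j - s' i)"
  shows "summary M P X Y Z s = summary M P X' Y' Z' s'"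
proof -
  have "(\<forall>j\<in>P. i < j \<longrightarrow> int M \<le> s j - s i) \<longleftrightarrow> (\<forall>j\<in>P. i < j \<longrightarrow> int M \<le> s' j - s' i)"
    if "i \<in> P" for i
    using assms(5)[OF that] by (auto simp: sim_def not_less[symmetric])
  then show ?thesis using assms(1-4) by (auto simp: summary_def fun_eq_iff)
qed

text \<open>Prefix sums of the prescribed gaps, shifted so that the value at \<open>m\<close> is
  \<open>z\<close>.\<close>

lemma ex_distance_function:
  fixes d :: "nat \<Rightarrow> nat \<Rightarrow> int"
  assumes "finite P"
  shows "\<exists>T. T m = z \<and> (\<forall>i j. adjacent id P i j \<longrightarrow> T j - T i = d i j)"
proof -
  \<comment> \<open>For the largest color of \<open>P\<close> this is an unspecified number, but
    that color contributes to no \<open>S j\<close> with \<open>j \<in> P\<close>.\<close>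
  define nx where "nx i = (THE j. adjacent id P i j)" for i
  define S where "S j = (\<Sum>i\<in>{i\<in>P. i < j}. d i (nx i))" for j
  have "S j - S i = d i j" if ij: "adjacent id P i j" for i j
  proof -
    have "nx i = j" unfolding nx_def
      by (rule the_equality) (use ij adjacent_unique(1)[of id P i] in auto)
    moreover have "{k \<in> P. k < j} = insert i {k \<in> P. k < i}"
      using ij by (auto simp: adjacent_def)
    ultimately show ?thesis using assms by (simp add: S_def)
  qed
  then show ?thesis by (intro exI[of _ "\<lambda>i. S i - S m + z"]) simp
qed

section \<open>Colored graphs of monotonic terms\<close>

lemma next_color_iff:
  assumes "finite P" "i \<in> P"
  shows "enat j = next_color P i \<longleftrightarrow> adjacent id P i j"
    and "enat j < next_color P i \<longleftrightarrow> (\<forall>k\<in>P. i < k \<longrightarrow> j < k)"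
proof -
  define A where "A = {j \<in> enat ` P \<union> {\<infinity>}. enat i < j}"
  have A: "finite A" "A \<noteq> {}" "next_color P i = Min A"
    using assms by (auto simp: A_def next_color_def)
  have "enat j = Min A \<longleftrightarrow> enat j \<in> A \<and> (\<forall>k\<in>A. enat j \<le> k)"
    by (subst eq_commute) (rule Min_eq_iff[OF A(1,2)])
  also have "\<dots> \<longleftrightarrow> (j \<in> P \<and> i < j) \<and> (\<forall>k\<in>P. i < k \<longrightarrow> j \<le> k)"
    by (auto simp: A_def)
  also have "\<dots> \<longleftrightarrow> adjacent id P i j"
    unfolding adjacent_def id_apply using assms(2) by (metis linorder_not_le)
  finally show "enat j = next_color P i \<longleftrightarrow> adjacent id P i j"
    unfolding A(3) .
  show "enat j < next_color P i \<longleftrightarrow> (\<forall>k\<in>P. i < k \<longrightarrow> j < k)"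
    unfolding A(3) Min_gr_iff[OF A(1,2)] by (auto simp: A_def)
qed

text \<open>The extra element 0 in \<open>prev_color\<close> is the source of \<open>0 < j\<close>;
  it lies below \<open>i\<close> because colors are positive.\<close>

lemma prev_color_iff:
  assumes "finite P" "0 < i"
  shows "prev_color P i < j \<longleftrightarrow> 0 < j \<and> (\<forall>k\<in>P. k < i \<longrightarrow> k < j)"
proof -
  have "finite {j \<in> P \<union> {0}. j < i}" "{j \<in> P \<union> {0}. j < i} \<noteq> {}" using assms by auto
  then show ?thesis unfolding prev_color_def by (subst Max_less_iff) (use assms in auto)
qed

lemma next_color_eq_iff:
  "finite P \<Longrightarrow> i \<in> P \<and> enat j = next_color P i \<longleftrightarrow> adjacent id P i j"
  using next_color_iff(1) by (metis adjacent_def)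

lemma rename_condition_iff:
  "\<lbrakk>finite P; 0 < i\<rbrakk> \<Longrightarrow> i \<in> P \<and> prev_color P i < j \<and> enat j < next_color P i \<longleftrightarrow>
     i \<in> P \<and> 0 < j \<and> (\<forall>k\<in>P. k < i \<longrightarrow> k < j) \<and> (\<forall>k\<in>P. i < k \<longrightarrow> j < k)"
  using next_color_iff(2) prev_color_iff by metis

lemma verts_simps [simp]:
  "verts (add_succ i j G) = verts G" "verts (add_time I i j G) = verts G"
  "verts (forget i G) = verts G" "verts (rename i j G) = verts G"
  "verts (leaf_graph i a) = {[]}"
  by (auto simp: add_succ_def add_time_def forget_def rename_def leaf_graph_def)

lemma succs_simps [simp]:
  "succs (add_succ i j G) = succs G \<union> colored_pair G i j" "succs (add_time I i j G) = succs G"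
  "succs (forget i G) = succs G" "succs (rename i j G) = succs G"
  "succs (leaf_graph i a) = {}"
  by (auto simp: add_succ_def add_time_def forget_def rename_def leaf_graph_def)

lemma timed_simps [simp]:
  "timed (add_succ i j G) = timed G"
  "timed (add_time I i j G) = (timed G)(I := timed G I \<union> colored_pair G i j)"
  "timed (forget i G) = timed G" "timed (rename i j G) = timed G"
  "timed (leaf_graph i a) = (\<lambda>I. {})"
  by (auto simp: add_succ_def add_time_def forget_def rename_def leaf_graph_def)

lemma col_simps [simp]:
  "col (add_succ i j G) = col G" "col (add_time I i j G) = col G"
  "col (forget i G) = (col G)(i := None)"
  "col (rename i j G) = (col G)(i := col G j, j := col G i)"
  "col (leaf_graph i a) = [i \<mapsto> []]"
  by (auto simp: add_succ_def add_time_def forget_def rename_def leaf_graph_def)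

lemma verts_graph_union [simp]:
  "verts (graph_union G H) = Cons False ` verts G \<union> Cons True ` verts H"
  by (simp add: graph_union_def Let_def)

lemma succs_graph_union:
  "(x, y) \<in> succs (graph_union G H) \<longleftrightarrow>
     (\<exists>u v. x = False # u \<and> y = False # v \<and> (u, v) \<in> succs G) \<or>
     (\<exists>u v. x = True # u \<and> y = True # v \<and> (u, v) \<in> succs H)"
  by (auto simp: graph_union_def Let_def image_iff map_prod_def split_beta) (metis fst_conv
    snd_conv)+

lemma timed_graph_union:
  "(x, y) \<in> timed (graph_union G H) I \<longleftrightarrow>
     (\<exists>u v. x = False # u \<and> y = False # v \<and> (u, v) \<in> timed G I) \<or>
     (\<exists>u v. x = True # u \<and> y = True # v \<and> (u, v) \<in> timed H I)"
  by (auto simp: graph_union_def Let_def image_iff map_prod_def split_beta) (metis fst_conv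
    snd_conv)+

lemma col_graph_union:
  assumes "dom (col G) \<inter> dom (col H) = {}"
  shows "col (graph_union G H) k = Some x \<longleftrightarrow>
     (\<exists>u. x = False # u \<and> col G k = Some u) \<or> (\<exists>u. x = True # u \<and> col H k = Some u)"
proof -
  have "col G k = None \<or> col H k = None" using assms by (auto simp: dom_def)
  then show ?thesis
    by (auto simp: graph_union_def Let_def map_add_def split: option.splits)
qed

lemma dom_col_graph_union [simp]:
  "dom (col (graph_union G H)) = dom (col G) \<union> dom (col H)"
  by (auto simp: graph_union_def Let_def map_add_def dom_def split: option.splits)

lemma trancl_succs_graph_union:
  assumes "(x, y) \<in> (succs (graph_union G H))\<^sup>+"
  shows "(\<exists>u v. x = False # u \<and> y = False # v \<and> (u, v) \<in> (succs G)\<^sup>+) \<or>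
     (\<exists>u v. x = True # u \<and> y = True # v \<and> (u, v) \<in> (succs H)\<^sup>+)"
  using assms
proof (induction rule: trancl_induct)
  case (base y)
  then show ?case by (auto simp: succs_graph_union)
next
  case (step y z)
  then show ?case by (auto simp: succs_graph_union intro: trancl_into_trancl)
qed

text \<open>An invariant of the semantics of monotonic terms. The last conjunct is the trace that
  monotonicity leaves on the graph: colors increase along paths between colored vertices. For
  \<open>i = j\<close> it excludes cycles through colored vertices.\<close>

definition wf_graph :: "nat \<Rightarrow> nat \<Rightarrow> 'a cgraph \<Rightarrow> bool" where
  "wf_graph K M G \<longleftrightarrow>
     finite (verts G) \<and> verts G \<noteq> {} \<and>
     ran (col G) \<subseteq> verts G \<and> dom (col G) \<subseteq> {1..K} \<and> inj_on (col G) (dom (col G)) \<and>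
     succs G \<subseteq> verts G \<times> verts G \<and>
     (\<forall>I. timed G I \<subseteq> verts G \<times> verts G) \<and> (\<forall>I. timed G I \<noteq> {} \<longrightarrow> I \<in> intervals M) \<and>
     (\<forall>i j u v. col G i = Some u \<longrightarrow> col G j = Some v \<longrightarrow> (u, v) \<in> (succs G)\<^sup>+ \<longrightarrow> i < j)"

lemma wf_graphD:
  assumes "wf_graph K M G"
  shows "finite (verts G)" "verts G \<noteq> {}" "dom (col G) \<subseteq> {1..K}" "finite (dom (col G))"
    "inj_on (col G) (dom (col G))"
    "col G i = Some u \<Longrightarrow> u \<in> verts G" "(u, v) \<in> succs G \<Longrightarrow> u \<in> verts G \<and> v \<in> verts G"
    "(u, v) \<in> timed G I \<Longrightarrow> u \<in> verts G \<and> v \<in> verts G"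
    "(u, v) \<in> timed G I \<Longrightarrow> I \<in> intervals M"
    "col G i = Some u \<Longrightarrow> col G j = Some v \<Longrightarrow> (u, v) \<in> (succs G)\<^sup>+ \<Longrightarrow> i < j"
    "col G i = Some u \<Longrightarrow> col G j = Some u \<Longrightarrow> i = j"
proof -
  show fin: "finite (dom (col G))"
    using assms unfolding wf_graph_def by (meson finite_atLeastAtMost finite_subset)
  show "col G i = Some u \<Longrightarrow> col G j = Some u \<Longrightarrow> i = j"
    using assms unfolding wf_graph_def by (metis domI inj_onD)
qed (use assms in \<open>unfold wf_graph_def, auto intro: ranI\<close>)

lemma wf_leaf_graph: "i \<in> {1..K} \<Longrightarrow> wf_graph K M (leaf_graph i a)"
  by (auto simp: wf_graph_def inj_on_def)

text \<open>A path that uses the new edge splits into a part leading to the vertex colored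
  \<open>i\<close> and a part starting at the one colored \<open>j\<close>. For the colors
  \<open>k\<close> and \<open>l\<close> of its ends this gives
  \<open>k \<le> i < j \<le> l\<close>.\<close>

lemma wf_add_succ:
  assumes "wf_graph K M G" "i < j"
  shows "wf_graph K M (add_succ i j G)"
proof (cases "\<exists>x y. col G i = Some x \<and> col G j = Some y")
  case True
  then obtain x y where xy: "col G i = Some x" "col G j = Some y" by blast
  then have *: "succs (add_succ i j G) = insert (x, y) (succs G)"
    by (auto simp: colored_pair_def)
  have le: "k \<le> l" if "col G k = Some u" "col G l = Some v" "(u, v) \<in> (succs G)\<^sup>*" for k l u v
    using that wf_graphD(10,11)[OF assms(1)] by (metis order.refl order.strict_implies_order
      rtranclD)
  have "k < l" if "col G k = Some u" "col G l = Some v"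
    "(u, v) \<in> (succs (add_succ i j G))\<^sup>+" for k l u v
    using that(3) unfolding * trancl_insert
    using wf_graphD(10)[OF assms(1) that(1,2)] le[OF that(1) xy(1)] le[OF xy(2) that(2)] assms(2)
    by auto
  then show ?thesis using assms(1) xy unfolding wf_graph_def * by (auto intro: ranI)
next
  case False
  then have "add_succ i j G = G" by (auto simp: add_succ_def colored_pair_def)
  then show ?thesis using assms by simp
qed

lemma wf_add_time:
  "wf_graph K M G \<Longrightarrow> I \<in> intervals M \<Longrightarrow> wf_graph K M (add_time I i j G)"
  unfolding wf_graph_def by (auto simp: colored_pair_def intro: ranI)

lemma wf_forget: "wf_graph K M G \<Longrightarrow> wf_graph K M (forget i G)"
  unfolding wf_graph_def by (auto simp: ran_def inj_on_def split: if_splits)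

text \<open>The transposition as a function on colors, so that renaming becomes composition of the
  coloring (and of the state) with it.\<close>

definition swap_color :: "nat \<Rightarrow> nat \<Rightarrow> nat \<Rightarrow> nat" where
  "swap_color i j k = (if k = i then j else if k = j then i else k)"

lemma swap_color_involutory [simp]: "swap_color i j (swap_color i j k) = k"
  by (simp add: swap_color_def)

text \<open>The hypotheses place \<open>j\<close> between the same active colors as
  \<open>i\<close>, and \<open>j\<close> itself is inactive unless \<open>j = i\<close>. So the
  transposition only moves one color within a gap between active colors.\<close>

lemma rename_order:
  assumes "i \<in> P" "\<forall>k\<in>P. k < i \<longrightarrow> k < j" "\<forall>k\<in>P. i < k \<longrightarrow> j < k"
    and "swap_color i j k \<in> P" "swap_color i j l \<in> P"
  shows "swap_color i j k < swap_color i j l \<longleftrightarrow> k < l"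
proof -
  have *: "(k < j \<longleftrightarrow> k < i) \<and> (j < k \<longleftrightarrow> i < k)" if "k \<in> P" "k \<noteq> i" for k
    using assms(2,3) that by (metis less_asym linorder_neqE_nat)
  have "j \<in> P \<Longrightarrow> j = i" using assms(2,3) by (metis less_irrefl linorder_neqE_nat)
  then have **: "k = j \<and> swap_color i j k = i \<or> k \<in> P \<and> k \<noteq> i \<and> swap_color i j k = k"
    if "swap_color i j k \<in> P" for k
    using that unfolding swap_color_def by metis
  show ?thesis using **[OF assms(4)] **[OF assms(5)] *[of k] *[of l] by (elim disjE conjE) simp_all
qed

lemma col_rename: "col (rename i j G) k = col G (swap_color i j k)"
  by (auto simp: swap_color_def)

lemma wf_rename:
  assumes wf: "wf_graph K M G" and ij: "i \<in> dom (col G)" "j \<in> {1..K}"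
    "\<forall>k\<in>dom (col G). k < i \<longrightarrow> k < j" "\<forall>k\<in>dom (col G). i < k \<longrightarrow> j < k"
  shows "wf_graph K M (rename i j G)"
proof -
  have "ran (col (rename i j G)) \<subseteq> verts G"
    using wf_graphD(6)[OF wf] unfolding ran_def col_rename by auto
  moreover have "k \<in> {1..K}" if "swap_color i j k \<in> dom (col G)" for k
    using that wf_graphD(3)[OF wf] ij(1,2) unfolding swap_color_def by (metis subsetD)
  then have "dom (col (rename i j G)) \<subseteq> {1..K}"
    unfolding dom_def col_rename by blast
  moreover have "inj_on (col (rename i j G)) (dom (col (rename i j G)))"
  proof (rule inj_onI)
    fix k l assume "k \<in> dom (col (rename i j G))" "col (rename i j G) k = col (rename i j G) l"
    then have "swap_color i j k = swap_color i j l"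
      using wf_graphD(11)[OF wf] unfolding dom_def col_rename by auto
    then show "k = l" by (metis swap_color_involutory)
  qed
  moreover have "k < l" if "col (rename i j G) k = Some u" "col (rename i j G) l = Some v"
    "(u, v) \<in> (succs G)\<^sup>+" for k l u v
    using wf_graphD(10)[OF wf, of "swap_color i j k" u "swap_color i j l" v] that
      rename_order[OF ij(1,3,4), of k l] unfolding col_rename by auto
  ultimately show ?thesis using wf unfolding wf_graph_def
    by (simp del: col_simps)
qed

lemma wf_graph_union:
  assumes wf: "wf_graph K M G" "wf_graph K M H" and disj: "dom (col G) \<inter> dom (col H) = {}"
  shows "wf_graph K M (graph_union G H)"
proof -
  note [simp] = col_graph_union[OF disj]
  have "ran (col (graph_union G H)) \<subseteq> verts (graph_union G H)"
    using wf_graphD(6)[OF wf(1)] wf_graphD(6)[OF wf(2)] by (auto simp: ran_def)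
  moreover have "k = l" if "col (graph_union G H) k = Some x" "col (graph_union G H) l = Some x"
    for k l x
    using that wf_graphD(11)[OF wf(1), of k _ l] wf_graphD(11)[OF wf(2), of k _ l] by auto
  then have "inj_on (col (graph_union G H)) (dom (col (graph_union G H)))"
    by (intro inj_onI) (metis domD)
  moreover have "succs (graph_union G H) \<subseteq> verts (graph_union G H) \<times> verts (graph_union G H)"
    using wf_graphD(7)[OF wf(1)] wf_graphD(7)[OF wf(2)] by (auto simp: succs_graph_union)
  moreover have "timed (graph_union G H) I \<subseteq> verts (graph_union G H) \<times> verts (graph_union G H)"
    for I
    using wf_graphD(8)[OF wf(1)] wf_graphD(8)[OF wf(2)] by (auto simp: timed_graph_union)
  moreover have "I \<in> intervals M" if "timed (graph_union G H) I \<noteq> {}" for I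
    using that wf_graphD(9)[OF wf(1)] wf_graphD(9)[OF wf(2)] by (auto simp: timed_graph_union)
  moreover have "k < l" if "col (graph_union G H) k = Some x" "col (graph_union G H) l = Some y"
    "(x, y) \<in> (succs (graph_union G H))\<^sup>+" for k l x y
    using trancl_succs_graph_union[OF that(3)] that(1,2)
      wf_graphD(10)[OF wf(1), of k _ l] wf_graphD(10)[OF wf(2), of k _ l] by auto
  ultimately show ?thesis
    using wf_graphD(1-3)[OF wf(1)] wf_graphD(1-3)[OF wf(2)] unfolding wf_graph_def
    by (intro conjI allI impI) (simp_all del: col_graph_union)
qed

lemma sem_active: "sem \<tau> = Some G \<Longrightarrow> active \<tau> = dom (col G)"
  by (simp add: active_def)

lemma wf_sem:
  "\<lbrakk>is_stt K M \<tau>; monotonic \<tau>; sem \<tau> = Some G\<rbrakk> \<Longrightarrow> wf_graph K M G"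
proof (induction \<tau> arbitrary: G)
  case (Leaf i a)
  then show ?case by (auto intro: wf_leaf_graph)
next
  case (AddSucc i j \<tau>)
  then obtain H where H: "sem \<tau> = Some H" "G = add_succ i j H" "wf_graph K M H" by auto
  then have "adjacent id (dom (col H)) i j"
    using AddSucc.prems(2) next_color_eq_iff[OF wf_graphD(4)[OF H(3)]]
    unfolding monotonic.simps sem_active[OF H(1)] by blast
  then show ?case using H by (auto simp: adjacent_def intro: wf_add_succ)
next
  case (AddTime I i j \<tau>)
  then show ?case by (auto intro: wf_add_time)
next
  case (Forget i \<tau>)
  then show ?case by (auto intro: wf_forget)
next
  case (Rename i j \<tau>)
  then obtain H where H: "sem \<tau> = Some H" "G = rename i j H" "wf_graph K M H" by auto
  have "0 < i" using Rename.prems(1) by auto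
  from rename_condition_iff[OF wf_graphD(4)[OF H(3)] this, of j] show ?case
    using Rename.prems(1,2) unfolding H(2) monotonic.simps sem_active[OF H(1)]
    by (intro wf_rename H) auto
next
  case (Oplus \<tau>1 \<tau>2)
  then show ?case by (auto split: option.splits if_splits intro: wf_graph_union)
qed

section \<open>Layouts\<close>

text \<open>\<open>pos\<close> numbers the vertices in the order in which they occur in the final word.\<close>

locale layout =
  fixes K M :: nat and G :: "'a cgraph" and pos :: "vertex \<Rightarrow> nat" and t :: "vertex \<Rightarrow> int"
  assumes wf: "wf_graph K M G"
    and inj_pos: "inj_on pos (verts G)"
    and succs_adjacent: "(u, v) \<in> succs G \<Longrightarrow> adjacent pos (verts G) u v"
    and uncolored: "v \<in> verts G \<Longrightarrow> v \<notin> ran (col G) \<Longrightarrow> v \<in> Domain (succs G) \<and> v \<in> Range (succs G)"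
    and col_mono: "\<lbrakk>col G i = Some u; col G j = Some v; i < j\<rbrakk> \<Longrightarrow> pos u < pos v"
    and time_mono: "\<lbrakk>u \<in> verts G; v \<in> verts G; pos u \<le> pos v\<rbrakk> \<Longrightarrow> t u \<le> t v"
    and timed: "(u, v) \<in> timed G I \<Longrightarrow> pos u < pos v \<and> real_of_int (t v - t u) \<in> I"
begin

lemma col_le_iff:
  "col G i = Some u \<Longrightarrow> col G j = Some v \<Longrightarrow> pos u \<le> pos v \<longleftrightarrow> i \<le> j"
  using col_mono[of i u j v] col_mono[of j v i u] by (cases i j rule: linorder_cases) auto

lemma col_less_iff:
  "col G i = Some u \<Longrightarrow> col G j = Some v \<Longrightarrow> pos u < pos v \<longleftrightarrow> i < j"
  using col_le_iff[of j v i u] by (simp add: not_le[symmetric])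

definition is_last_color :: "vertex \<Rightarrow> nat \<Rightarrow> bool" where
  "is_last_color v i \<longleftrightarrow> (\<exists>u. col G i = Some u \<and> pos u \<le> pos v \<and> (u, v) \<in> (succs G)\<^sup>*) \<and>
     (\<forall>k x. col G k = Some x \<longrightarrow> pos x \<le> pos v \<longrightarrow> k \<le> i)"

definition last_color :: "vertex \<Rightarrow> nat" where
  "last_color v = (SOME i. is_last_color v i)"

text \<open>Walk back along edges from \<open>v\<close> until a colored point appears: uncolored
  points have a predecessor. Edges join neighbours of the position order, so no colored point is
  skipped, and the color found is the largest one at or before \<open>v\<close>.\<close>

lemma ex_last_color: "v \<in> verts G \<Longrightarrow> \<exists>i. is_last_color v i"
proof (induction "pos v" arbitrary: v rule: less_induct)
  case less
  show ?case
  proof (cases "v \<in> ran (col G)")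
    case True
    then obtain i where "col G i = Some v" by (auto simp: ran_def)
    then show ?thesis using col_le_iff unfolding is_last_color_def by blast
  next
    case False
    then obtain w where w: "(w, v) \<in> succs G" using uncolored less.prems by blast
    then have adj: "w \<in> verts G" "pos w < pos v" "\<And>x. x \<in> verts G \<Longrightarrow> pos x < pos v \<Longrightarrow> pos x \<le> pos w"
      using succs_adjacent by (auto simp: adjacent_def not_less[symmetric])
    obtain i u where i: "col G i = Some u" "pos u \<le> pos w" "(u, w) \<in> (succs G)\<^sup>*"
      and last: "\<And>k x. col G k = Some x \<Longrightarrow> pos x \<le> pos w \<Longrightarrow> k \<le> i"
      using less.hyps[OF adj(2,1)] by (auto simp: is_last_color_def)
    have "k \<le> i" if "col G k = Some x" "pos x \<le> pos v" for k x
    proof -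
      have "x \<noteq> v" "x \<in> verts G" using that(1) False wf_graphD(6)[OF wf] by (auto simp: ran_def)
      then have "pos x < pos v" using that(2) inj_pos less.prems by (auto simp: inj_on_def le_less)
      then show ?thesis using adj(3) last that(1) \<open>x \<in> verts G\<close> by blast
    qed
    then show ?thesis using i w adj(2) unfolding is_last_color_def
      by (meson le_trans less_imp_le rtrancl_into_rtrancl)
  qed
qed

lemma last_color:
  assumes "v \<in> verts G"
  obtains u where "col G (last_color v) = Some u" "pos u \<le> pos v" "(u, v) \<in> (succs G)\<^sup>*"
  using someI_ex[OF ex_last_color[OF assms]] unfolding last_color_def is_last_color_def by blast

lemma last_color_ge:
  "v \<in> verts G \<Longrightarrow> col G k = Some x \<Longrightarrow> pos x \<le> pos v \<Longrightarrow> k \<le> last_color v"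
  using someI_ex[OF ex_last_color] unfolding last_color_def is_last_color_def by blast

lemma last_color_col: "col G i = Some u \<Longrightarrow> last_color u = i"
  using last_color last_color_ge col_le_iff wf_graphD(6)[OF wf]
  by (metis dual_order.antisym order_refl)

lemma last_color_mono:
  "u \<in> verts G \<Longrightarrow> v \<in> verts G \<Longrightarrow> pos u \<le> pos v \<Longrightarrow> last_color u \<le> last_color v"
  by (metis last_color last_color_ge le_trans)

text \<open>The mirror image of the walk back: now the induction measures the distance to the last
  position.\<close>

lemma ex_first_color:
  assumes "v \<in> verts G"
  shows "\<exists>i u. col G i = Some u \<and> pos v \<le> pos u \<and> (v, u) \<in> (succs G)\<^sup>* \<and>
    (\<forall>k x. col G k = Some x \<longrightarrow> pos v \<le> pos x \<longrightarrow> i \<le> k)"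
  using assms
proof (induction "Max (pos ` verts G) - pos v" arbitrary: v rule: less_induct)
  case less
  show ?case
  proof (cases "v \<in> ran (col G)")
    case True
    then obtain i where "col G i = Some v" by (auto simp: ran_def)
    then show ?thesis using col_le_iff by blast
  next
    case False
    then obtain w where w: "(v, w) \<in> succs G" using uncolored less.prems by blast
    then have adj: "w \<in> verts G" "pos v < pos w" "\<And>x. x \<in> verts G \<Longrightarrow> pos v < pos x \<Longrightarrow> pos w \<le> pos x"
      using succs_adjacent by (auto simp: adjacent_def not_less[symmetric])
    have "pos w \<le> Max (pos ` verts G)" using adj(1) wf_graphD(1)[OF wf] by auto
    then have "Max (pos ` verts G) - pos w < Max (pos ` verts G) - pos v" using adj(2) by linarith
    from less.hyps[OF this adj(1)]
    obtain i u where i: "col G i = Some u" "pos w \<le> pos u" "(w, u) \<in> (succs G)\<^sup>*"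
      and first: "\<And>k x. col G k = Some x \<Longrightarrow> pos w \<le> pos x \<Longrightarrow> i \<le> k" by blast
    have "i \<le> k" if "col G k = Some x" "pos v \<le> pos x" for k x
    proof -
      have "x \<noteq> v" "x \<in> verts G" using that(1) False wf_graphD(6)[OF wf] by (auto simp: ran_def)
      then have "pos v < pos x" using that(2) inj_pos less.prems by (auto simp: inj_on_def le_less)
      then show ?thesis using adj(3) first that(1) \<open>x \<in> verts G\<close> by blast
    qed
    then show ?thesis using i w adj(2)
      by (meson converse_rtrancl_into_rtrancl le_trans less_imp_le)
  qed
qed

text \<open>The position after \<open>u\<close> is held by an uncolored point, since a color there
  would exceed \<open>i\<close> although it occurs at or before \<open>v\<close>. Being uncolored,
  that point has an incoming edge, and this edge can only start at its neighbour
  \<open>u\<close>.\<close>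

lemma gap_in_Domain:
  assumes "col G i = Some u" "v \<in> verts G" "pos u < pos v"
    and "\<And>j w. col G j = Some w \<Longrightarrow> pos w \<le> pos v \<Longrightarrow> j \<le> i"
  shows "u \<in> Domain (succs G)"
proof -
  obtain w where w: "adjacent pos (verts G) u w" "pos w \<le> pos v"
    using adjacent_next[OF wf_graphD(6)[OF wf assms(1)] assms(2,3)] by blast
  have "w \<notin> ran (col G)"
  proof
    assume "w \<in> ran (col G)"
    then obtain j where j: "col G j = Some w" by (auto simp: ran_def)
    then show False using assms(4)[OF j w(2)] w(1) col_less_iff[OF assms(1) j]
      by (auto simp: adjacent_def)
  qed
  then obtain x where "(x, w) \<in> succs G" using uncolored w(1) by (auto simp: adjacent_def)
  then show ?thesis using adjacent_unique(2)[OF inj_pos w(1)] succs_adjacent by blast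
qed

lemma last_color_Domain:
  assumes "v \<in> verts G" "col G (last_color v) = Some u" "u \<noteq> v"
  shows "u \<in> Domain (succs G)"
proof (rule gap_in_Domain[OF assms(2,1)])
  show "pos u < pos v"
    using last_color[OF assms(1)] assms inj_pos wf_graphD(6)[OF wf assms(2)]
    by (metis inj_onD le_neq_implies_less option.inject)
qed (use last_color_ge[OF assms(1)] in blast)

text \<open>The edge leads to a later point, and from there \<open>ex_first_color\<close> reaches a
  colored point; so some active color exceeds \<open>i\<close>.\<close>

lemma next_color_exists:
  assumes "col G i = Some u" "u \<in> Domain (succs G)"
  obtains j where "adjacent id (dom (col G)) i j"
proof -
  obtain w where "(u, w) \<in> succs G" using assms by blast
  then have w: "w \<in> verts G" "pos u < pos w" using succs_adjacent by (auto simp: adjacent_def)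
  obtain j x where j: "col G j = Some x" "pos w \<le> pos x" using ex_first_color[OF w(1)] by blast
  then have "i < j" using col_less_iff[OF assms(1) j(1)] w by auto
  then show ?thesis using adjacent_next[of i "dom (col G)" j id] assms(1) j(1) that by auto
qed

lemma adjacent_colors:
  "col G i = Some u \<Longrightarrow> col G j = Some v \<Longrightarrow> adjacent pos (verts G) u v \<Longrightarrow>
    adjacent id (dom (col G)) i j"
  using col_less_iff wf_graphD(6)[OF wf] unfolding adjacent_def by (force simp: dom_def)

end

section \<open>States read off a graph with time stamps\<close>

definition outs :: "'a cgraph \<Rightarrow> nat set" where
  "outs G = {i. \<exists>u. col G i = Some u \<and> u \<in> Domain (succs G)}"

definition ins :: "'a cgraph \<Rightarrow> nat set" where
  "ins G = {i. \<exists>u. col G i = Some u \<and> u \<in> Range (succs G)}"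

definition dirs :: "'a cgraph \<Rightarrow> nat set" where
  "dirs G = {i. \<exists>u v. col G i = Some u \<and> (u, v) \<in> succs G \<and> v \<in> ran (col G)}"

definition stamp :: "'a cgraph \<Rightarrow> (vertex \<Rightarrow> int) \<Rightarrow> nat \<Rightarrow> int" where
  "stamp G t i = t (the (col G i))"

definition graph_state ::
  "nat \<Rightarrow> 'a cgraph \<Rightarrow> (vertex \<Rightarrow> int) \<Rightarrow> state" where
  "graph_state M G t = summary M (dom (col G)) (outs G) (ins G) (dirs G) (stamp G t)"

lemma (in layout) mono_stamp: "mono_on (dom (col G)) (stamp G t)"
  using col_le_iff wf_graphD(6)[OF wf] time_mono by (auto simp: mono_on_def stamp_def)

section \<open>Leaves, and restriction of layouts to the arguments of an operation\<close>

lemma layout_leaf: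
  "i \<in> {1..K} \<Longrightarrow> layout K M (leaf_graph i a) pos t"
  by unfold_locales (auto intro: wf_leaf_graph split: if_splits)

lemma layout_add_succD:
  assumes "wf_graph K M G" "layout K M (add_succ i j G) pos t"
  shows "layout K M G pos t"
proof -
  interpret A: layout K M "add_succ i j G" pos t by fact
  show ?thesis
  proof
    show "v \<in> Domain (succs G) \<and> v \<in> Range (succs G)" if "v \<in> verts G" "v \<notin> ran (col G)" for v
      using A.uncolored[of v] that by (auto simp: colored_pair_def ran_def)
  qed (use assms(1) A.inj_pos A.succs_adjacent A.col_mono A.time_mono A.timed in auto)
qed

lemma layout_add_timeD:
  assumes "wf_graph K M G" "layout K M (add_time I i j G) pos t"
  shows "layout K M G pos t"
proof -
  interpret A: layout K M "add_time I i j G" pos t by fact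
  show ?thesis
  proof
    show "pos u < pos v \<and> real_of_int (t v - t u) \<in> J" if "(u, v) \<in> timed G J" for u v J
      using A.timed[of u v J] that by (cases "J = I") simp_all
  qed (use assms(1) A.inj_pos A.succs_adjacent A.uncolored A.col_mono A.time_mono in auto)
qed

text \<open>The point of the forgotten color lies inside a block, where colors increase along the edges;
  this places it correctly between the remaining colored points.\<close>

lemma layout_forgetD:
  assumes wf: "wf_graph K M G" and "layout K M (forget i G) pos t"
  shows "layout K M G pos t"
proof -
  interpret A: layout K M "forget i G" pos t by fact
  have colA: "col (forget i G) k = Some x \<longleftrightarrow> col G k = Some x \<and> k \<noteq> i" for k x by auto
  show ?thesis
  proof
    fix v assume v: "v \<in> verts G" "v \<notin> ran (col G)"
    then have "v \<notin> ran (col (forget i G))" by (auto simp: ran_def)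
    then show "v \<in> Domain (succs G) \<and> v \<in> Range (succs G)" using A.uncolored[of v] v by simp
  next
    fix k l u v assume col: "col G k = Some u" "col G l = Some v" "k < l"
    note V = wf_graphD(6)[OF wf col(1)] wf_graphD(6)[OF wf col(2)]
    have "u \<noteq> v" using col wf_graphD(11)[OF wf] by blast
    then have ne: "pos u \<noteq> pos v" using A.inj_pos V by (auto simp: inj_on_def)
    consider "k \<noteq> i" "l \<noteq> i" | "k = i" | "l = i" by blast
    then show "pos u < pos v"
    proof cases
      case 1
      then show ?thesis using A.col_mono[of k u l v] col by simp
    next
      case 2
      obtain c a where c: "col (forget i G) c = Some a" "(a, u) \<in> (succs G)\<^sup>*"
        and last: "\<And>m x. col (forget i G) m = Some x \<Longrightarrow> pos x \<le> pos u \<Longrightarrow> m \<le> c"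
        using A.ex_last_color[of u] V unfolding A.is_last_color_def verts_simps succs_simps by blast
      have c': "col G c = Some a" "c \<noteq> i" using c(1) unfolding colA by auto
      then have "a \<noteq> u" using col(1) 2 wf_graphD(11)[OF wf] by blast
      then have "c < i" using c(2) c' col(1) 2 wf_graphD(10)[OF wf] by (metis rtranclD)
      moreover have "col (forget i G) l = Some v" using col 2 by simp
      ultimately show ?thesis using last[of l v] col 2 ne by linarith
    next
      case 3
      obtain c a where c: "col (forget i G) c = Some a" "(v, a) \<in> (succs G)\<^sup>*"
        and first: "\<And>m x. col (forget i G) m = Some x \<Longrightarrow> pos v \<le> pos x \<Longrightarrow> c \<le> m"
        using A.ex_first_color[of v] V unfolding verts_simps succs_simps by blast
      have c': "col G c = Some a" "c \<noteq> i" using c(1) unfolding colA by auto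
      then have "v \<noteq> a" using col(2) 3 wf_graphD(11)[OF wf] by blast
      then have "i < c" using c(2) c' col(2) 3 wf_graphD(10)[OF wf] by (metis rtranclD)
      moreover have "col (forget i G) k = Some u" using col 3 by simp
      ultimately show ?thesis using first[of k u] col 3 ne by linarith
    qed
  qed (use wf A.inj_pos A.succs_adjacent A.time_mono A.timed in auto)
qed

lemma ran_col_rename: "ran (col (rename i j G)) = ran (col G)"
  unfolding ran_def col_rename by (metis swap_color_involutory)

lemma layout_rename_iff:
  assumes wf: "wf_graph K M G" and ij: "i \<in> dom (col G)" "j \<in> {1..K}"
    "\<forall>k\<in>dom (col G). k < i \<longrightarrow> k < j" "\<forall>k\<in>dom (col G). i < k \<longrightarrow> j < k"
  shows "layout K M (rename i j G) pos t \<longleftrightarrow> layout K M G pos t"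
proof -
  let ?\<rho> = "swap_color i j"
  have order: "?\<rho> k < ?\<rho> l \<longleftrightarrow> k < l" if "col G (?\<rho> k) = Some u" "col G (?\<rho> l) = Some v" for k l u v
    by (rule rename_order[OF ij(1,3,4)]) (use that in auto)
  show ?thesis
  proof
    assume "layout K M (rename i j G) pos t"
    then interpret R: layout K M "rename i j G" pos t .
    show "layout K M G pos t"
    proof
      fix k l u v assume col: "col G k = Some u" "col G l = Some v" and "k < l"
      then have "?\<rho> k < ?\<rho> l" using order[of "?\<rho> k" u "?\<rho> l" v] by simp
      then show "pos u < pos v" using R.col_mono[of "?\<rho> k" u "?\<rho> l" v] col unfolding col_rename
        by simp
    qed (use wf R.inj_pos R.succs_adjacent R.uncolored R.time_mono R.timed in
        \<open>simp_all add: ran_col_rename del: col_simps\<close>)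
  next
    assume "layout K M G pos t"
    then interpret A: layout K M G pos t .
    show "layout K M (rename i j G) pos t"
    proof
      fix k l u v assume col: "col (rename i j G) k = Some u" "col (rename i j G) l = Some v" and
        "k < l"
      then show "pos u < pos v" using A.col_mono order unfolding col_rename by blast
    qed (use wf_rename[OF assms] A.inj_pos A.succs_adjacent A.uncolored A.time_mono A.timed in
        \<open>simp_all add: ran_col_rename del: col_simps\<close>)
  qed
qed

text \<open>Neighbours in the whole order remain neighbours in a part of it, and every edge stays
  within one of the two arguments, so uncolored points find both neighbours on their own
  side.\<close>

lemma layout_graph_unionD:
  assumes wf: "wf_graph K M G" "wf_graph K M H" and disj: "dom (col G) \<inter> dom (col H) = {}"
    and "layout K M (graph_union G H) pos t"
  shows "layout K M G (pos \<circ> Cons False) (t \<circ> Cons False)"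
    and "layout K M H (pos \<circ> Cons True) (t \<circ> Cons True)"
proof -
  interpret A: layout K M "graph_union G H" pos t by fact
  note col = col_graph_union[OF disj]
  have ran: "False # v \<in> ran (col (graph_union G H)) \<longleftrightarrow> v \<in> ran (col G)"
    "True # v \<in> ran (col (graph_union G H)) \<longleftrightarrow> v \<in> ran (col H)" for v
    by (auto simp: ran_def col)
  have Domain: "False # v \<in> Domain (succs (graph_union G H)) \<longleftrightarrow> v \<in> Domain (succs G)"
    "False # v \<in> Range (succs (graph_union G H)) \<longleftrightarrow> v \<in> Range (succs G)"
    "True # v \<in> Domain (succs (graph_union G H)) \<longleftrightarrow> v \<in> Domain (succs H)"
    "True # v \<in> Range (succs (graph_union G H)) \<longleftrightarrow> v \<in> Range (succs H)" for v
    by (auto simp: Domain_iff Range_iff succs_graph_union)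
  show "layout K M G (pos \<circ> Cons False) (t \<circ> Cons False)"
  proof
    show "adjacent (pos \<circ> Cons False) (verts G) u v" if "(u, v) \<in> succs G" for u v
      using A.succs_adjacent[of "False # u" "False # v"] that
        by (auto simp: adjacent_def succs_graph_union)
    show "v \<in> Domain (succs G) \<and> v \<in> Range (succs G)" if "v \<in> verts G" "v \<notin> ran (col G)" for v
      using A.uncolored[of "False # v"] that unfolding ran Domain by simp
    show "(pos \<circ> Cons False) u < (pos \<circ> Cons False) v" if "col G i = Some u" "col G j = Some v"
      "i < j" for i j u v
      using A.col_mono[of i "False # u" j "False # v"] that by (simp add: col)
    show "(t \<circ> Cons False) u \<le> (t \<circ> Cons False) v"
      if "u \<in> verts G" "v \<in> verts G" "(pos \<circ> Cons False) u \<le> (pos \<circ> Cons False) v" for u v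
      using A.time_mono[of "False # u" "False # v"] that by simp
    show "(pos \<circ> Cons False) u < (pos \<circ> Cons False) v \<and>
      real_of_int ((t \<circ> Cons False) v - (t \<circ> Cons False) u) \<in> I"
      if "(u, v) \<in> timed G I" for u v I
      using A.timed[of "False # u" "False # v" I] that by (simp add: timed_graph_union)
    show "inj_on (pos \<circ> Cons False) (verts G)"
      by (rule comp_inj_on[OF _ inj_on_subset[OF A.inj_pos]]) auto
  qed (rule wf)
  show "layout K M H (pos \<circ> Cons True) (t \<circ> Cons True)"
  proof
    show "adjacent (pos \<circ> Cons True) (verts H) u v" if "(u, v) \<in> succs H" for u v
      using A.succs_adjacent[of "True # u" "True # v"] that
        by (auto simp: adjacent_def succs_graph_union)
    show "v \<in> Domain (succs H) \<and> v \<in> Range (succs H)" if "v \<in> verts H" "v \<notin> ran (col H)" for v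
      using A.uncolored[of "True # v"] that unfolding ran Domain by simp
    show "(pos \<circ> Cons True) u < (pos \<circ> Cons True) v" if "col H i = Some u" "col H j = Some v"
      "i < j" for i j u v
      using A.col_mono[of i "True # u" j "True # v"] that by (simp add: col)
    show "(t \<circ> Cons True) u \<le> (t \<circ> Cons True) v"
      if "u \<in> verts H" "v \<in> verts H" "(pos \<circ> Cons True) u \<le> (pos \<circ> Cons True) v" for u v
      using A.time_mono[of "True # u" "True # v"] that by simp
    show "(pos \<circ> Cons True) u < (pos \<circ> Cons True) v \<and>
      real_of_int ((t \<circ> Cons True) v - (t \<circ> Cons True) u) \<in> I"
      if "(u, v) \<in> timed H I" for u v I
      using A.timed[of "True # u" "True # v" I] that by (simp add: timed_graph_union)
    show "inj_on (pos \<circ> Cons True) (verts H)"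
      by (rule comp_inj_on[OF _ inj_on_subset[OF A.inj_pos]]) auto
  qed (rule wf)
qed

section \<open>Effect of the operations on the state\<close>

lemma summary_eqI:
  assumes "\<And>i. i \<in> P \<Longrightarrow> i \<in> X \<longleftrightarrow> i \<in> X'" "\<And>i. i \<in> P \<Longrightarrow> i \<in> Y \<longleftrightarrow> i \<in> Y'"
    "\<And>i. i \<in> P \<Longrightarrow> i \<in> Z \<longleftrightarrow> i \<in> Z'" "\<And>i. i \<in> P \<Longrightarrow> s i = s' i"
  shows "summary M P X Y Z s = summary M P X' Y' Z' s'"
  using assms by (auto simp: summary_def fun_eq_iff)

text \<open>The last component compares colors, so this depends on
  \<open>rename_order\<close>.\<close>

lemma summary_swap_color:
  assumes ij: "i \<in> P" "\<forall>k\<in>P. k < i \<longrightarrow> k < j" "\<forall>k\<in>P. i < k \<longrightarrow> j < k"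
  shows "summary M P X Y Z s \<circ> swap_color i j =
    summary M {k. swap_color i j k \<in> P} {k. swap_color i j k \<in> X} {k. swap_color i j k \<in> Y}
      {k. swap_color i j k \<in> Z} (s \<circ> swap_color i j)"
proof
  fix k
  let ?\<rho> = "swap_color i j"
  have "(\<forall>l\<in>P. ?\<rho> k < l \<longrightarrow> int M \<le> s l - s (?\<rho> k)) \<longleftrightarrow>
    (\<forall>l\<in>{l. ?\<rho> l \<in> P}. k < l \<longrightarrow> int M \<le> (s \<circ> ?\<rho>) l - (s \<circ> ?\<rho>) k)" if "?\<rho> k \<in> P"
  proof (intro iffI ballI impI)
    fix l assume all: "\<forall>l\<in>P. ?\<rho> k < l \<longrightarrow> int M \<le> s l - s (?\<rho> k)" and l: "l \<in> {l. ?\<rho> l \<in> P}" "k < l"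
    then have "?\<rho> l \<in> P" "?\<rho> k < ?\<rho> l" using rename_order[OF ij that] by auto
    then show "int M \<le> (s \<circ> ?\<rho>) l - (s \<circ> ?\<rho>) k" using all by auto
  next
    fix l assume all: "\<forall>l\<in>{l. ?\<rho> l \<in> P}. k < l \<longrightarrow> int M \<le> (s \<circ> ?\<rho>) l - (s \<circ> ?\<rho>) k"
      and l: "l \<in> P" "?\<rho> k < l"
    then have "k < ?\<rho> l" using rename_order[OF ij that, of "?\<rho> l"] by simp
    then show "int M \<le> s l - s (?\<rho> k)" using all[rule_format, of "?\<rho> l"] l by simp
  qed
  then show "(summary M P X Y Z s \<circ> ?\<rho>) k = summary M {k. ?\<rho> k \<in> P} {k. ?\<rho> k \<in> X} {k. ?\<rho> k \<in> Y}
      {k. ?\<rho> k \<in> Z} (s \<circ> ?\<rho>) k"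
    by (simp add: summary_def)
qed

lemma flags_subset: "outs G \<subseteq> dom (col G)" "ins G \<subseteq> dom (col G)" "dirs G \<subseteq> dom (col G)"
  by (auto simp: outs_def ins_def dirs_def)

lemma flags_add_succ:
  assumes "wf_graph K M G" "col G i = Some u" "col G j = Some v"
  shows "outs (add_succ i j G) = insert i (outs G)" "ins (add_succ i j G) = insert j (ins G)"
    "dirs (add_succ i j G) = insert i (dirs G)"
proof -
  have "succs (add_succ i j G) = insert (u, v) (succs G)" "v \<in> ran (col G)"
    using assms(2,3) by (auto simp: colored_pair_def ran_def)
  moreover have "col G k = Some u \<longleftrightarrow> k = i" "col G k = Some v \<longleftrightarrow> k = j" for k
    using wf_graphD(11)[OF assms(1)] assms(2,3) by blast+
  ultimately show "outs (add_succ i j G) = insert i (outs G)"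
    "ins (add_succ i j G) = insert j (ins G)"
    "dirs (add_succ i j G) = insert i (dirs G)"
    unfolding outs_def ins_def dirs_def col_simps by auto
qed

lemma graph_state_add_succ:
  assumes "wf_graph K M G" "i \<in> dom (col G)" "j \<in> dom (col G)"
  shows "graph_state M (add_succ i j G) t =
    summary M (dom (col G)) (insert i (outs G)) (insert j (ins G)) (insert i (dirs G)) (stamp G t)"
proof -
  obtain u v where "col G i = Some u" "col G j = Some v" using assms(2,3) by blast
  note flags_add_succ[OF assms(1) this]
  then show ?thesis by (simp add: graph_state_def stamp_def[abs_def])
qed

lemma graph_state_add_time: "graph_state M (add_time I i j G) t = graph_state M G t"
  by (simp add: graph_state_def stamp_def[abs_def] outs_def ins_def dirs_def)

text \<open>A color loses this flag exactly when its edge ends at the forgotten point. The ends of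
  an edge between colored points have consecutive active colors, so the state reveals this case: the
  flag is set and \<open>i\<close> is the next active color.\<close>

lemma (in layout) dirs_forget:
  "dirs (forget i G) = {k \<in> dirs G. \<not> adjacent id (dom (col G)) k i} - {i}"
proof -
  have "k \<in> dirs (forget i G) \<longleftrightarrow> k \<in> dirs G \<and> \<not> adjacent id (dom (col G)) k i \<and> k \<noteq> i" for k
  proof (cases "k \<in> dirs G")
    case True
    then obtain u v j where k: "col G k = Some u" "(u, v) \<in> succs G" "col G j = Some v"
      by (auto simp: dirs_def ran_def)
    have "adjacent id (dom (col G)) k j"
      using adjacent_colors[OF k(1,3)] succs_adjacent k(2) by blast
    then have "adjacent id (dom (col G)) k i \<longleftrightarrow> j = i" using adjacent_unique(1)[of id] by auto
    moreover have "k \<in> dirs (forget i G) \<longleftrightarrow> k \<noteq> i \<and> j \<noteq> i"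
    proof
      assume "k \<in> dirs (forget i G)"
      then obtain w l where "k \<noteq> i" "(u, w) \<in> succs G" "l \<noteq> i" "col G l = Some w"
        using k(1) by (auto simp: dirs_def ran_def split: if_splits)
      moreover have "w = v"
        using adjacent_unique(1)[OF inj_pos succs_adjacent succs_adjacent] calculation(2) k(2)
          by blast
      ultimately show "k \<noteq> i \<and> j \<noteq> i" using k(3) wf_graphD(11)[OF wf] by blast
    next
      assume "k \<noteq> i \<and> j \<noteq> i"
      then have "col (forget i G) k = Some u" "v \<in> ran (col (forget i G))"
        using k by (auto intro!: ranI[of _ j])
      then show "k \<in> dirs (forget i G)" using k(2) unfolding dirs_def succs_simps by blast
    qed
    ultimately show ?thesis using True by blast
  next
    case False
    then show ?thesis by (auto simp: dirs_def ran_def split: if_splits)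
  qed
  then show ?thesis by blast
qed

lemma (in layout) graph_state_forget:
  "graph_state M (forget i G) t =
    summary M (dom (col G) - {i}) (outs G) (ins G) {k \<in> dirs G. \<not> adjacent id (dom (col G)) k i}
      (stamp G t)"
proof -
  have "dom (col (forget i G)) = dom (col G) - {i}" by auto
  then show ?thesis
    unfolding graph_state_def dirs_forget
    by (simp del: col_simps, intro summary_eqI) (auto simp: outs_def ins_def stamp_def)
qed

lemma graph_state_rename:
  assumes "i \<in> dom (col G)" "\<forall>k\<in>dom (col G). k < i \<longrightarrow> k < j" "\<forall>k\<in>dom (col G). i < k \<longrightarrow> j < k"
  shows "graph_state M (rename i j G) t = graph_state M G t \<circ> swap_color i j"
proof -
  have "dom (col (rename i j G)) = {k. swap_color i j k \<in> dom (col G)}"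
    unfolding dom_def col_rename by auto
  moreover have "outs (rename i j G) = {k. swap_color i j k \<in> outs G}"
    "ins (rename i j G) = {k. swap_color i j k \<in> ins G}"
      "dirs (rename i j G) = {k. swap_color i j k \<in> dirs G}"
    unfolding outs_def ins_def dirs_def col_rename ran_col_rename succs_simps by auto
  moreover have "stamp (rename i j G) t = stamp G t \<circ> swap_color i j"
    unfolding stamp_def[abs_def] col_rename comp_def ..
  ultimately show ?thesis unfolding graph_state_def summary_swap_color[OF assms] by simp
qed

lemma flags_graph_union:
  assumes "dom (col G) \<inter> dom (col H) = {}"
  shows "outs (graph_union G H) = outs G \<union> outs H" "ins (graph_union G H) = ins G \<union> ins H"
    "dirs (graph_union G H) = dirs G \<union> dirs H"
  by (auto simp: outs_def ins_def dirs_def ran_def col_graph_union[OF assms] succs_graph_union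
    Domain_iff Range_iff)
     blast+

lemma stamp_graph_union:
  assumes "dom (col G) \<inter> dom (col H) = {}"
  shows "k \<in> dom (col G) \<Longrightarrow> stamp (graph_union G H) t k = stamp G (t \<circ> Cons False) k"
    and "k \<in> dom (col H) \<Longrightarrow> stamp (graph_union G H) t k = stamp H (t \<circ> Cons True) k"
proof -
  show "stamp (graph_union G H) t k = stamp G (t \<circ> Cons False) k" if k: "k \<in> dom (col G)"
  proof -
    obtain u where "col G k = Some u" using k by blast
    moreover from this have "col (graph_union G H) k = Some (False # u)"
      by (simp add: col_graph_union[OF assms])
    ultimately show ?thesis by (simp add: stamp_def)
  qed
  show "stamp (graph_union G H) t k = stamp H (t \<circ> Cons True) k" if k: "k \<in> dom (col H)"
  proof -
    obtain u where "col H k = Some u" using k by blast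
    moreover from this have "col (graph_union G H) k = Some (True # u)"
      by (simp add: col_graph_union[OF assms])
    ultimately show ?thesis by (simp add: stamp_def)
  qed
qed

text \<open>\<open>S\<close> will be one argument of a disjoint union, and the claim becomes a
  premise of rule \<open>oplus\<close>. Let \<open>v\<close> be the last point of \<open>S\<close>
  before \<open>y\<close>. A successor of \<open>v\<close> would belong to \<open>S\<close> and
  still come before \<open>y\<close>; so \<open>v\<close> has none and must be colored. It differs
  from \<open>u\<close>, which has a successor.\<close>

lemma (in layout) block_contiguous:
  assumes S: "S \<subseteq> verts G" "\<And>x y. (x, y) \<in> succs G \<Longrightarrow> x \<in> S \<Longrightarrow> y \<in> S"
    and u: "col G i = Some u" "u \<in> S" "u \<in> Domain (succs G)"
    and y: "col G k = Some y" "y \<notin> S" and "i < k"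
  shows "\<exists>j v. col G j = Some v \<and> v \<in> S \<and> i < j \<and> j < k"
proof -
  define B where "B = {x \<in> S. pos x < pos y}"
  have "finite B" "u \<in> B" using S(1) wf_graphD(1)[OF wf] u col_mono[OF u(1) y(1) \<open>i < k\<close>]
    by (auto simp: B_def intro: finite_subset)
  then have "Max (pos ` B) \<in> pos ` B" by (intro Max_in) auto
  then obtain v where v: "v \<in> B" and "pos v = Max (pos ` B)" by auto
  then have max: "pos x \<le> pos v" if "x \<in> B" for x using \<open>finite B\<close> that by simp
  have "v \<notin> Domain (succs G)"
  proof
    assume "v \<in> Domain (succs G)"
    then obtain z where z: "(v, z) \<in> succs G" by blast
    then have adj: "adjacent pos (verts G) v z" and "z \<in> S"
      using succs_adjacent S(2) v by (auto simp: B_def)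
    have "pos z \<le> pos y"
      using adj v wf_graphD(6)[OF wf y(1)] by (auto simp: adjacent_def B_def not_less[symmetric])
    moreover have "pos z \<noteq> pos y"
      using inj_pos y \<open>z \<in> S\<close> S(1) wf_graphD(6)[OF wf y(1)] by (metis inj_onD subsetD)
    ultimately have "z \<in> B" using \<open>z \<in> S\<close> by (simp add: B_def)
    then show False using max adj by (auto simp: adjacent_def not_less[symmetric])
  qed
  moreover have "v \<in> verts G" using v S(1) by (auto simp: B_def)
  ultimately have "v \<in> ran (col G)" using uncolored by blast
  then obtain j where j: "col G j = Some v" by (auto simp: ran_def)
  have "v \<noteq> u" using \<open>v \<notin> Domain (succs G)\<close> u(3) by blast
  then have "i \<noteq> j" using u(1) j by auto
  moreover have "i \<le> j" using max[OF \<open>u \<in> B\<close>] col_le_iff[OF u(1) j] by simp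
  moreover have "j < k" using v col_less_iff[OF j y(1)] by (simp add: B_def)
  ultimately have "i < j" "j < k" by simp_all
  then show ?thesis using j v unfolding B_def by blast
qed

section \<open>The automaton\<close>

text \<open>Links the representative in a rule with the one coming from the graph: if they have the
  same state before an operation that keeps the stamps, they have the same state after it.
  \<open>Q\<close> is the set of colors that remain active.\<close>

lemma summary_transfer:
  assumes eq: "summary M P X Y Z s = summary M P' X' Y' Z' s'" and M: "0 < M"
    and mono: "mono_on P s" "mono_on P s'" and "Q \<subseteq> P"
    and flags: "\<And>i. i \<in> Q \<Longrightarrow> i \<in> A \<longleftrightarrow> i \<in> A'" "\<And>i. i \<in> Q \<Longrightarrow> i \<in> B \<longleftrightarrow> i \<in> B'"
      "\<And>i. i \<in> Q \<Longrightarrow> i \<in> C \<longleftrightarrow> i \<in> C'"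
  shows "summary M Q A B C s = summary M Q A' B' C' s'"
proof (rule summary_cong)
  have P': "P' = P" using summary_eqD(1)[OF eq M] by simp
  show "s i mod int M = s' i mod int M" if "i \<in> Q" for i
    using summary_eqD(5)[OF eq M] that \<open>Q \<subseteq> P\<close> by blast
  show "sim M (s j - s i) (s' j - s' i)" if "i \<in> Q" "j \<in> Q" "i < j" for i j
    by (rule summary_eq_sim[OF eq[unfolded P'] M mono]) (use that \<open>Q \<subseteq> P\<close> in auto)
qed (use flags in auto)

text \<open>In rule \<open>add_succ\<close>, the color \<open>i\<close> may already have an outgoing edge if this is the very edge
  that is added again.\<close>

inductive stt_rule :: "nat \<Rightarrow> nat \<Rightarrow> 'a stt_op \<Rightarrow> state list \<Rightarrow> state \<Rightarrow> bool" for K M where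
  leaf: "i \<in> {1..K} \<Longrightarrow> stt_rule K M (LeafOp i a) [] (summary M {i} {} {} {} s)"
| add_succ: "\<lbrakk>P \<subseteq> {1..K}; mono_on P s; adjacent id P i j; i \<in> X \<longrightarrow> i \<in> Z\<rbrakk> \<Longrightarrow>
    stt_rule K M (AddSuccOp i j) [summary M P X Y Z s]
      (summary M P (insert i X) (insert j Y) (insert i Z) s)"
| add_time: "\<lbrakk>P \<subseteq> {1..K}; mono_on P s; I \<in> intervals M; i \<in> {1..K}; j \<in> {1..K}; i < j;
      i \<in> P \<longrightarrow> j \<in> P \<longrightarrow> real_of_int (s j - s i) \<in> I\<rbrakk> \<Longrightarrow>
    stt_rule K M (AddTimeOp I i j) [summary M P X Y Z s] (summary M P X Y Z s)"
| forget: "\<lbrakk>P \<subseteq> {1..K}; mono_on P s; i \<in> {1..K}; i \<in> P \<longrightarrow> i \<in> X \<and> i \<in> Y\<rbrakk> \<Longrightarrow>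
    stt_rule K M (ForgetOp i) [summary M P X Y Z s]
      (summary M (P - {i}) X Y {k \<in> Z. \<not> adjacent id P k i} s)"
| rename: "\<lbrakk>P \<subseteq> {1..K}; i \<in> P; j \<in> {1..K}; \<forall>k\<in>P. k < i \<longrightarrow> k < j; \<forall>k\<in>P. i < k \<longrightarrow> j < k\<rbrakk> \<Longrightarrow>
    stt_rule K M (RenameOp i j) [summary M P X Y Z s] (summary M P X Y Z s \<circ> swap_color i j)"
| oplus: "\<lbrakk>P \<union> P' \<subseteq> {1..K}; P \<inter> P' = {}; mono_on (P \<union> P') s;
      X \<subseteq> P; Y \<subseteq> P; Z \<subseteq> P; X' \<subseteq> P'; Y' \<subseteq> P'; Z' \<subseteq> P';
      \<forall>i\<in>X. \<forall>k\<in>P'. i < k \<longrightarrow> (\<exists>j\<in>P. i < j \<and> j < k);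
      \<forall>i\<in>X'. \<forall>k\<in>P. i < k \<longrightarrow> (\<exists>j\<in>P'. i < j \<and> j < k)\<rbrakk> \<Longrightarrow>
    stt_rule K M OplusOp [summary M P X Y Z s, summary M P' X' Y' Z' s]
      (summary M (P \<union> P') (X \<union> X') (Y \<union> Y') (Z \<union> Z') s)"

definition stt_states :: "nat \<Rightarrow> nat \<Rightarrow> state set" where
  "stt_states K M = {q. dom q \<subseteq> {1..K} \<and> ran q \<subseteq> UNIV \<times> {..<M} \<times> UNIV}"

text \<open>The condition on final states allows at most two active colors, as
  \<open>i < j < k\<close> would contradict \<open>k \<le> j\<close>. If there are two, the edge
  leaving the smaller one closes the only gap that can remain in the word.\<close>

definition stt_nta :: "nat \<Rightarrow> nat \<Rightarrow> ('a stt_op, state) nta" where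
  "stt_nta K M =
     \<lparr>states = stt_states K M,
      final = {q. \<exists>P X Y Z s. q = summary M P X Y Z s \<and> P \<subseteq> {1..K} \<and>
        (\<forall>i\<in>P. \<forall>j\<in>P. i < j \<longrightarrow> i \<in> X \<and> (\<forall>k\<in>P. k \<le> j))},
      rules = {(f, qs, q). stt_rule K M f qs q}\<rparr>"

lemma reaches_stt_nta:
  "stt_rule K M f qs q \<Longrightarrow> list_all2 (reaches (stt_nta K M)) ts qs \<Longrightarrow>
    reaches (stt_nta K M) (Node f ts) q"
  by (rule reaches.intros) (simp add: stt_nta_def)

text \<open>A layout of the whole graph restricts to every subterm, so one choice of positions and
  stamps guides the entire run.\<close>

lemma reaches_graph_state:
  "\<lbrakk>is_stt K M \<tau>; monotonic \<tau>; sem \<tau> = Some G; layout K M G pos t\<rbrakk> \<Longrightarrow>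
     reaches (stt_nta K M) (tree_of \<tau>) (graph_state M G t)"
proof (induction \<tau> arbitrary: G pos t)
  case (Leaf i a)
  have "graph_state M (leaf_graph i a) t = summary M {i} {} {} {} (stamp (leaf_graph i a) t)"
    by (simp add: graph_state_def outs_def ins_def dirs_def)
  then show ?case using Leaf stt_rule.leaf[of i K M a] by (auto intro!: reaches_stt_nta)
next
  case (AddSucc i j \<tau>)
  then obtain H where \<tau>: "sem \<tau> = Some H" and G: "G = add_succ i j H" by auto
  have wf: "wf_graph K M H" using wf_sem \<tau> AddSucc.prems by auto
  interpret A: layout K M "add_succ i j H" pos t using AddSucc.prems G by simp
  interpret layout K M H pos t by (rule layout_add_succD[OF wf A.layout_axioms])
  have adj: "adjacent id (dom (col H)) i j"
    using AddSucc.prems(2) next_color_eq_iff[OF wf_graphD(4)[OF wf]]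
    unfolding monotonic.simps sem_active[OF \<tau>] by blast
  then have dom: "i \<in> dom (col H)" "j \<in> dom (col H)" by (auto simp: adjacent_def)
  then obtain u v where uv: "col H i = Some u" "col H j = Some v" by blast
  \<comment> \<open>In the layout of the larger graph \<open>u\<close> and \<open>v\<close> are
    neighbours, so an edge that already leaves \<open>u\<close> must end at
    \<open>v\<close>.\<close>
  have "i \<in> dirs H" if "i \<in> outs H"
  proof -
    obtain w where w: "(u, w) \<in> succs H" using \<open>i \<in> outs H\<close> uv by (auto simp: outs_def)
    have "adjacent pos (verts H) u v"
      using A.succs_adjacent[of u v] uv by (simp add: colored_pair_def)
    then have "w = v" using adjacent_unique(1)[OF inj_pos] succs_adjacent[OF w] by blast
    then show ?thesis using uv w by (auto simp: dirs_def intro: ranI)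
  qed
  then show ?case
    using AddSucc.IH[OF _ _ \<tau> layout_axioms] AddSucc.prems wf_graphD(3)[OF wf] adj mono_stamp
    unfolding G graph_state_add_succ[OF wf dom] tree_of.simps
    by (intro reaches_stt_nta[OF stt_rule.add_succ]) (auto simp: graph_state_def)
next
  case (AddTime I i j \<tau>)
  then obtain H where \<tau>: "sem \<tau> = Some H" and G: "G = add_time I i j H" by auto
  have wf: "wf_graph K M H" using wf_sem \<tau> AddTime.prems by auto
  interpret A: layout K M "add_time I i j H" pos t using AddTime.prems G by simp
  interpret layout K M H pos t by (rule layout_add_timeD[OF wf A.layout_axioms])
  have "real_of_int (stamp H t j - stamp H t i) \<in> I" if "i \<in> dom (col H)" "j \<in> dom (col H)"
  proof -
    obtain u v where "col H i = Some u" "col H j = Some v" using \<open>i \<in> dom (col H)\<close> \<open>j \<in> dom (col H)\<close>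
      by blast
    then show ?thesis using A.timed[of u v I] by (simp add: colored_pair_def stamp_def)
  qed
  then show ?case
    using AddTime.IH[OF _ _ \<tau> layout_axioms] AddTime.prems wf_graphD(3)[OF wf] mono_stamp
    unfolding G graph_state_add_time tree_of.simps
    unfolding graph_state_def
    by (intro reaches_stt_nta[OF stt_rule.add_time]) auto
next
  case (Forget i \<tau>)
  then obtain H where \<tau>: "sem \<tau> = Some H" and G: "G = forget i H" by auto
  have wf: "wf_graph K M H" using wf_sem \<tau> Forget.prems by auto
  interpret A: layout K M "forget i H" pos t using Forget.prems G by simp
  interpret layout K M H pos t by (rule layout_forgetD[OF wf A.layout_axioms])
  \<comment> \<open>After the operation the point of color \<open>i\<close> is uncolored, and the
    layout of the resulting graph grants it both neighbours.\<close>
  have "i \<in> outs H \<and> i \<in> ins H" if "i \<in> dom (col H)"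
  proof -
    obtain u where u: "col H i = Some u" using \<open>i \<in> dom (col H)\<close> by blast
    then have "u \<notin> ran (col (forget i H))" "u \<in> verts H"
      using wf_graphD(6,11)[OF wf] by (auto simp: ran_def)
    then show ?thesis using A.uncolored[of u] u by (auto simp: outs_def ins_def)
  qed
  then show ?case
    using Forget.IH[OF _ _ \<tau> layout_axioms] Forget.prems wf_graphD(3)[OF wf] mono_stamp
    unfolding G graph_state_forget tree_of.simps
    unfolding graph_state_def
    by (intro reaches_stt_nta[OF stt_rule.forget]) auto
next
  case (Rename i j \<tau>)
  then obtain H where \<tau>: "sem \<tau> = Some H" and G: "G = rename i j H" by auto
  have wf: "wf_graph K M H" using wf_sem \<tau> Rename.prems by auto
  have ij: "i \<in> dom (col H)" "j \<in> {1..K}"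
    "\<forall>k\<in>dom (col H). k < i \<longrightarrow> k < j" "\<forall>k\<in>dom (col H). i < k \<longrightarrow> j < k"
    using Rename.prems(1,2) rename_condition_iff[OF wf_graphD(4)[OF wf], of i j]
    unfolding monotonic.simps sem_active[OF \<tau>] by auto
  have lay: "layout K M H pos t" using Rename.prems(4) layout_rename_iff[OF wf ij] G by simp
  show ?case
    using Rename.IH[OF _ _ \<tau> lay] Rename.prems wf_graphD(3)[OF wf] ij
    unfolding G graph_state_rename[OF ij(1,3,4)] tree_of.simps
    unfolding graph_state_def
    by (intro reaches_stt_nta[OF stt_rule.rename]) auto
next
  case (Oplus \<tau>1 \<tau>2)
  then obtain G1 G2 where \<tau>: "sem \<tau>1 = Some G1" "sem \<tau>2 = Some G2" and G: "G = graph_union G1 G2"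
    and disj: "dom (col G1) \<inter> dom (col G2) = {}" by (auto split: option.splits if_splits)
  have wf: "wf_graph K M G1" "wf_graph K M G2" using wf_sem \<tau> Oplus.prems by auto
  interpret A: layout K M "graph_union G1 G2" pos t using Oplus.prems G by simp
  note lay = layout_graph_unionD[OF wf disj A.layout_axioms]
  note col = col_graph_union[OF disj]
  have "\<exists>j\<in>dom (col G1). i < j \<and> j < k" if i: "i \<in> outs G1" and k: "k \<in> dom (col G2)" "i < k"
    for i k
  proof -
    obtain u y where "col G1 i = Some u" "u \<in> Domain (succs G1)" "col G2 k = Some y"
      using i k by (auto simp: outs_def)
    then have "\<exists>j v. col (graph_union G1 G2) j = Some v \<and> v \<in> Cons False ` verts G1 \<and> i < j \<and> j < k"
      using wf_graphD(6,7)[OF wf(1)] \<open>i < k\<close>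
      by (intro A.block_contiguous[where u = "False # u" and y = "True # y"])
        (auto simp: col succs_graph_union Domain_iff)
    then show ?thesis by (auto simp: col)
  qed
  moreover have "\<exists>j\<in>dom (col G2). i < j \<and> j < k" if i: "i \<in> outs G2" and k: "k \<in> dom (col G1)"
    "i < k" for i k
  proof -
    obtain u y where "col G2 i = Some u" "u \<in> Domain (succs G2)" "col G1 k = Some y"
      using i k by (auto simp: outs_def)
    then have "\<exists>j v. col (graph_union G1 G2) j = Some v \<and> v \<in> Cons True ` verts G2 \<and> i < j \<and> j < k"
      using wf_graphD(6,7)[OF wf(2)] \<open>i < k\<close>
      by (intro A.block_contiguous[where u = "True # u" and y = "False # y"])
        (auto simp: col succs_graph_union Domain_iff)
    then show ?thesis by (auto simp: col)
  qed
  \<comment> \<open>The stamps of the union play the role of the common \<open>s\<close> of rule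
    \<open>oplus\<close>.\<close>
  ultimately have rule: "stt_rule K M OplusOp
    [summary M (dom (col G1)) (outs G1) (ins G1) (dirs G1) (stamp (graph_union G1 G2) t),
     summary M (dom (col G2)) (outs G2) (ins G2) (dirs G2) (stamp (graph_union G1 G2) t)]
    (graph_state M (graph_union G1 G2) t)"
    unfolding graph_state_def dom_col_graph_union flags_graph_union[OF disj]
    using wf_graphD(3)[OF wf(1)] wf_graphD(3)[OF wf(2)] disj A.mono_stamp flags_subset
    by (intro stt_rule.oplus) (simp_all add: Un_subset_iff)
  have "summary M (dom (col G1)) (outs G1) (ins G1) (dirs G1) (stamp (graph_union G1 G2) t)
      = graph_state M G1 (t \<circ> Cons False)"
    "summary M (dom (col G2)) (outs G2) (ins G2) (dirs G2) (stamp (graph_union G1 G2) t)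
      = graph_state M G2 (t \<circ> Cons True)"
    unfolding graph_state_def by (intro summary_eqI refl stamp_graph_union[OF disj]; assumption)+
  note rule' = rule[unfolded this]
  have "reaches (stt_nta K M) (tree_of \<tau>1) (graph_state M G1 (t \<circ> Cons False))"
    "reaches (stt_nta K M) (tree_of \<tau>2) (graph_state M G2 (t \<circ> Cons True))"
    by (rule Oplus.IH(1)[OF _ _ \<tau>(1) lay(1)] Oplus.IH(2)[OF _ _ \<tau>(2) lay(2)];
        use Oplus.prems(1,2) in simp)+
  then show ?case
    unfolding G tree_of.simps by (intro reaches_stt_nta[OF rule'] list.rel_intros)
qed

section \<open>Merging layouts\<close>

text \<open>The point is that \<open>u\<close> and \<open>v\<close> are neighbours. If an edge
  leaves \<open>u\<close> already, it ends at a colored point, whose color must be the next one,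
  \<open>j\<close>. If none does, a point strictly between \<open>u\<close> and \<open>v\<close>
  would force one by \<open>gap_in_Domain\<close>.\<close>

lemma (in layout) layout_add_succ:
  assumes "wf_graph K M (add_succ i j G)" and adj: "adjacent id (dom (col G)) i j"
    and dirs: "i \<in> outs G \<Longrightarrow> i \<in> dirs G"
  shows "layout K M (add_succ i j G) pos t"
proof -
  obtain u v where uv: "col G i = Some u" "col G j = Some v" and "i < j"
    using adj by (auto simp: adjacent_def)
  have between: "k \<le> i" if "col G k = Some x" "pos x < pos v" for k x
  proof -
    have "k \<in> dom (col G)" "k < j" using that col_less_iff[OF that(1) uv(2)] by auto
    then show ?thesis using adj unfolding adjacent_def id_apply by (meson not_le)
  qed
  have "adjacent pos (verts G) u v"
  proof (cases "i \<in> outs G")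
    case True
    then obtain w l where w: "(u, w) \<in> succs G" "col G l = Some w"
      using dirs uv by (auto simp: dirs_def ran_def)
    then have "adjacent id (dom (col G)) i l"
      using adjacent_colors uv(1) succs_adjacent by blast
    then have "l = j" using adjacent_unique(1)[of id] adj by auto
    then show ?thesis using w uv succs_adjacent by auto
  next
    case False
    then have "u \<notin> Domain (succs G)" using uv(1) by (auto simp: outs_def)
    moreover have "k \<le> i" if "col G k = Some x" "pos x \<le> pos w" "pos w < pos v" for k x w
      using between that by force
    ultimately have "\<not> (pos u < pos w \<and> pos w < pos v)" if "w \<in> verts G" for w
      using gap_in_Domain[OF uv(1) that] by blast
    then show ?thesis
      using col_mono[OF uv \<open>i < j\<close>] wf_graphD(6)[OF wf uv(1)] wf_graphD(6)[OF wf uv(2)]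
      by (auto simp: adjacent_def)
  qed
  moreover have "succs (add_succ i j G) = insert (u, v) (succs G)"
    using uv by (auto simp: colored_pair_def)
  ultimately show ?thesis
    using assms(1) inj_pos succs_adjacent uncolored col_mono time_mono timed
    by unfold_locales auto
qed

lemma (in layout) layout_add_time:
  assumes "wf_graph K M (add_time I i j G)" and "i < j"
    and "\<And>u v. col G i = Some u \<Longrightarrow> col G j = Some v \<Longrightarrow> real_of_int (t v - t u) \<in> I"
  shows "layout K M (add_time I i j G) pos t"
proof
  show "pos u < pos v \<and> real_of_int (t v - t u) \<in> J" if "(u, v) \<in> timed (add_time I i j G) J"
    for u v J
    using that timed[of u v J] assms(2,3) col_mono[of i u j v]
    by (auto simp: colored_pair_def split: if_splits)
qed (use assms(1) inj_pos succs_adjacent uncolored col_mono time_mono in auto)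

lemma (in layout) layout_forget:
  assumes "wf_graph K M (forget i G)" and "i \<in> dom (col G) \<Longrightarrow> i \<in> outs G \<and> i \<in> ins G"
  shows "layout K M (forget i G) pos t"
proof
  fix v assume v: "v \<in> verts (forget i G)" "v \<notin> ran (col (forget i G))"
  show "v \<in> Domain (succs (forget i G)) \<and> v \<in> Range (succs (forget i G))"
  proof (cases "v \<in> ran (col G)")
    case True
    then obtain k where k: "col G k = Some v" by (auto simp: ran_def)
    have "k = i" using v(2) k by (auto simp: ran_def split: if_splits)
    then show ?thesis using k assms(2) by (auto simp: outs_def ins_def)
  qed (use v uncolored in auto)
qed (use assms(1) inj_pos succs_adjacent col_mono time_mono timed in \<open>auto split: if_splits\<close>)

text \<open>Between two colored points the time stamps of a layout may be replaced by \<open>T\<close>, provided that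
  \<open>T\<close> agrees with the old stamps inside the blocks of \<open>\<rightarrow>\<close>-connected points and only stretches or
  shrinks those gaps between blocks that remain at least \<open>M\<close> wide.\<close>

locale retimed_layout = layout K M G pos t
  for K M :: nat and G :: "'a cgraph" and pos :: "vertex \<Rightarrow> nat" and t :: "vertex \<Rightarrow> int" +
  fixes P :: "nat set" and T :: "nat \<Rightarrow> int"
  assumes dom_subset: "dom (col G) \<subseteq> P"
    and contiguous: "\<lbrakk>i \<in> outs G; k \<in> P - dom (col G); i < k\<rbrakk> \<Longrightarrow> \<exists>j \<in> dom (col G). i < j \<and> j < k"
    and T_mono: "mono_on P T"
    and T_block: "\<lbrakk>i \<in> outs G; adjacent id (dom (col G)) i j\<rbrakk> \<Longrightarrow> T j - T i =
      stamp G t j - stamp G t i"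
    and T_sim: "\<lbrakk>i \<in> dom (col G); j \<in> dom (col G); i < j\<rbrakk> \<Longrightarrow>
      sim M (T j - T i) (stamp G t j - stamp G t i)"
begin

text \<open>Each point keeps its distance to the last colored point at or before it, so the pieces
  of a block between consecutive colors move rigidly.\<close>

definition retime :: "vertex \<Rightarrow> int" where
  "retime x = T (last_color x) + (t x - stamp G t (last_color x))"

lemma last_color_dom: "x \<in> verts G \<Longrightarrow> last_color x \<in> dom (col G)"
  by (erule last_color) blast

lemma retime_col: "col G i = Some u \<Longrightarrow> retime u = T i"
  by (simp add: retime_def stamp_def last_color_col)

lemma retime_ge:
  assumes "x \<in> verts G"
  shows "T (last_color x) \<le> retime x"
proof -
  obtain u where u: "col G (last_color x) = Some u" "pos u \<le> pos x" by (rule last_color[OF assms])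
  then have "t u \<le> t x" using time_mono wf_graphD(6)[OF wf] assms by blast
  then show ?thesis using u by (simp add: retime_def stamp_def)
qed

text \<open>A color of the other argument strictly between \<open>i\<close> and \<open>j\<close>
  would, by \<open>contiguous\<close>, have an own color between itself and \<open>i\<close>,
  against the choice of \<open>j\<close>.\<close>

lemma no_color_inside:
  assumes "i \<in> outs G" "adjacent id (dom (col G)) i j" "k \<in> P" "i < k"
  shows "j \<le> k"
proof (cases "k \<in> dom (col G)")
  case False
  then obtain l where "l \<in> dom (col G)" "i < l" "l < k" using contiguous assms by blast
  then show ?thesis using assms(2) by (force simp: adjacent_def)
qed (use assms in \<open>auto simp: adjacent_def\<close>)

text \<open>An anchor to the right of \<open>x\<close>: the first colored point at or after
  \<open>x\<close> keeps its distance to \<open>x\<close> as well. If \<open>x\<close> is colored it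
  is its own anchor; otherwise \<open>x\<close> lies inside a block and \<open>T_block\<close>
  applies.\<close>

lemma next_stamp:
  assumes x: "x \<in> verts G"
  obtains i where "i \<in> dom (col G)" "T i - retime x = stamp G t i - t x" "t x \<le> stamp G t i"
    "last_color x \<le> i" "\<forall>k\<in>P. last_color x < k \<longrightarrow> i \<le> k"
proof -
  obtain u where u: "col G (last_color x) = Some u" "pos u \<le> pos x" by (rule last_color[OF x])
  show ?thesis
  proof (cases "u = x")
    case True
    then have "stamp G t (last_color x) = t x" using u by (simp add: stamp_def)
    then show ?thesis
      by (intro that[of "last_color x"] last_color_dom[OF x]) (simp_all add: retime_def)
  next
    case False
    then have "u \<in> Domain (succs G)" by (rule last_color_Domain[OF x u(1)])
    then have out: "last_color x \<in> outs G" using u(1) by (auto simp: outs_def)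
    obtain j where j: "adjacent id (dom (col G)) (last_color x) j"
      by (rule next_color_exists[OF u(1) \<open>u \<in> Domain (succs G)\<close>])
    then obtain v where v: "col G j = Some v" and "last_color x < j" by (auto simp: adjacent_def)
    have "pos x \<le> pos v" using last_color_ge[OF x v] \<open>last_color x < j\<close> by linarith
    then have "t x \<le> t v" by (rule time_mono[OF x wf_graphD(6)[OF wf v]])
    show ?thesis
    proof (rule that[of j])
      show "t x \<le> stamp G t j" using \<open>t x \<le> t v\<close> v by (simp add: stamp_def)
      show "T j - retime x = stamp G t j - t x"
        using T_block[OF out j] by (simp add: retime_def)
      show "\<forall>k\<in>P. last_color x < k \<longrightarrow> j \<le> k" using no_color_inside[OF out j] by blast
    qed (use v \<open>last_color x < j\<close> in auto)
  qed
qed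

lemma retime_le:
  assumes "x \<in> verts G" "k \<in> P" "last_color x < k"
  shows "retime x \<le> T k"
proof -
  obtain i where i: "i \<in> dom (col G)" "T i - retime x = stamp G t i - t x" "t x \<le> stamp G t i"
    "last_color x \<le> i" "\<forall>k\<in>P. last_color x < k \<longrightarrow> i \<le> k"
    by (rule next_stamp[OF assms(1)])
  have "i \<in> P" "i \<le> k" using i(1,5) assms(2,3) dom_subset by auto
  then have "T i \<le> T k" using assms(2) by (intro mono_onD[OF T_mono])
  then show ?thesis using i(2,3) by linarith
qed

lemma retime_mono:
  assumes "x \<in> verts G" "y \<in> verts G" "pos x \<le> pos y"
  shows "retime x \<le> retime y"
proof (cases "last_color x = last_color y")
  case True
  then show ?thesis using time_mono[OF assms] by (simp add: retime_def)
next
  case False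
  then have "last_color x < last_color y" using last_color_mono[OF assms] by simp
  moreover have "last_color y \<in> P" using last_color_dom[OF assms(2)] dom_subset by blast
  ultimately have "retime x \<le> T (last_color y)" by (intro retime_le[OF assms(1)])
  then show ?thesis using retime_ge[OF assms(2)] by linarith
qed

text \<open>If the last colors differ, the distance from \<open>x\<close> to \<open>y\<close> splits
  at the right anchor of \<open>x\<close> and at the last color of \<open>y\<close>. The two outer
  parts are nonnegative and unchanged, the middle one changes only up to \<open>sim\<close>. So the
  total is unchanged, or at least \<open>M\<close> before and after.\<close>

lemma retime_timed:
  assumes xy: "(x, y) \<in> timed G I"
  shows "real_of_int (retime y - retime x) \<in> I"
proof -
  have x: "x \<in> verts G" and y: "y \<in> verts G" using wf_graphD(8)[OF wf xy] by auto
  have "pos x < pos y" "real_of_int (t y - t x) \<in> I" using timed[OF xy] by auto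
  have "t y - t x = retime y - retime x \<or> int M \<le> t y - t x \<and> int M \<le> retime y - retime x"
  proof (cases "last_color x = last_color y")
    case False
    then have less: "last_color x < last_color y"
      using last_color_mono[OF x y] \<open>pos x < pos y\<close> by simp
    obtain i where i: "i \<in> dom (col G)" "T i - retime x = stamp G t i - t x" "t x \<le> stamp G t i"
      "last_color x \<le> i" "\<forall>k\<in>P. last_color x < k \<longrightarrow> i \<le> k"
      by (rule next_stamp[OF x])
    have le: "i \<le> last_color y" using i(5) less last_color_dom[OF y] dom_subset by blast
    have "sim M (T (last_color y) - T i) (stamp G t (last_color y) - stamp G t i)"
      using T_sim[OF i(1) last_color_dom[OF y]] le sim_refl[of 0] by (cases "i = last_color y") auto
    moreover have "retime y = T (last_color y) + (t y - stamp G t (last_color y))"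
      by (simp add: retime_def)
    moreover note i(2,3) retime_ge[OF y]
    ultimately show ?thesis by (elim sim_cases) linarith+
  qed (simp add: retime_def)
  from interval_sim[OF wf_graphD(9)[OF wf xy] this \<open>real_of_int (t y - t x) \<in> I\<close>] show ?thesis .
qed

text \<open>Keeps foreign points out of edges when two layouts are interleaved. A foreign color
  strictly between the last colors of \<open>x\<close> and \<open>y\<close> would lie beyond the
  next own color after \<open>x\<close>, whose point would then separate the neighbours
  \<open>x\<close> and \<open>y\<close>.\<close>

lemma edge_gap:
  assumes xy: "(x, y) \<in> succs G" and k: "k \<in> P" "last_color x < k"
  shows "last_color y \<le> k"
proof (rule ccontr)
  assume "\<not> last_color y \<le> k"
  then have "k < last_color y" by simp
  note adj = succs_adjacent[OF xy]
  have x: "x \<in> verts G" and y: "y \<in> verts G" using wf_graphD(7)[OF wf xy] by auto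
  obtain v where v: "col G (last_color y) = Some v" "pos v \<le> pos y" by (rule last_color[OF y])
  obtain u where u: "col G (last_color x) = Some u" "pos u \<le> pos x" by (rule last_color[OF x])
  have "u \<in> Domain (succs G)" using last_color_Domain[OF x u(1)] xy by blast
  then have out: "last_color x \<in> outs G" using u by (auto simp: outs_def)
  obtain j where j: "adjacent id (dom (col G)) (last_color x) j"
    by (rule next_color_exists[OF u(1) \<open>u \<in> Domain (succs G)\<close>])
  then obtain w where w: "col G j = Some w" "last_color x < j" by (auto simp: adjacent_def)
  have "j < last_color y" using no_color_inside[OF out j k] \<open>k < last_color y\<close> by linarith
  then have "pos w < pos y" using col_mono[OF w(1) v(1)] v(2) by linarith
  moreover have "pos x < pos w" using last_color_ge[OF x w(1)] w(2) by linarith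
  ultimately show False using adj wf_graphD(6)[OF wf w(1)] by (auto simp: adjacent_def)
qed

end

text \<open>The gaps between consecutive colors of \<open>P\<close> are prescribed: the distance in
  the own layout if the first color has an outgoing edge, the distance in \<open>s\<close>
  otherwise. By contiguity, in the first case the next color of \<open>P\<close> belongs to the same
  argument, so its own stamp is meaningful.\<close>

lemma ex_retiming:
  fixes Gs :: "bool \<Rightarrow> 'a cgraph"
  defines "P \<equiv> \<Union>b. dom (col (Gs b))"
  assumes M: "0 < M"
    and lay: "\<And>b. layout K M (Gs b) (ps b) (ts b)"
    and disj: "dom (col (Gs False)) \<inter> dom (col (Gs True)) = {}"
    and contig: "\<And>b i k. \<lbrakk>i \<in> outs (Gs b); k \<in> P - dom (col (Gs b)); i < k\<rbrakk> \<Longrightarrow>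
      \<exists>j \<in> dom (col (Gs b)). i < j \<and> j < k"
    and s_mono: "mono_on P s"
    and s_sim: "\<And>b i j. \<lbrakk>i \<in> dom (col (Gs b)); j \<in> dom (col (Gs b)); i < j\<rbrakk> \<Longrightarrow>
      sim M (s j - s i) (stamp (Gs b) (ts b) j - stamp (Gs b) (ts b) i)"
  shows "\<exists>T. (\<forall>b. retimed_layout K M (Gs b) (ps b) (ts b) P T) \<and>
    (\<forall>i\<in>P. T i mod int M = s i mod int M) \<and>
    (\<forall>i\<in>P. \<forall>j\<in>P. i < j \<longrightarrow> sim M (T j - T i) (s j - s i))"
proof -
  define side where "side i \<longleftrightarrow> i \<in> dom (col (Gs True))" for i
  have side: "side i = b" if "i \<in> dom (col (Gs b))" for i b
    using disj that unfolding side_def by (cases b) auto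
  have "finite P" unfolding P_def using wf_graphD(4)[OF layout.wf[OF lay]] by auto
  define d where "d i j = (if i \<in> outs (Gs (side i))
      then stamp (Gs (side i)) (ts (side i)) j - stamp (Gs (side i)) (ts (side i)) i
      else s j - s i)" for i j
  \<comment> \<open>Fixing the value at the least color turns similarity of distances into equality
    of residues for all colors.\<close>
  obtain T where T_Min: "T (Min P) = s (Min P)" and T: "\<And>i j. adjacent id P i j \<Longrightarrow> T j - T i = d i j"
    using ex_distance_function[OF \<open>finite P\<close>, of "Min P" "s (Min P)" d] by blast
  have d_sim: "sim M (d i j) (s j - s i)" if adj: "adjacent id P i j" for i j
  proof (cases "i \<in> outs (Gs (side i))")
    case True
    let ?G = "Gs (side i)"
    have i: "i \<in> dom (col ?G)" using True flags_subset by blast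
    have "j \<in> dom (col ?G)"
    proof (rule ccontr)
      assume "j \<notin> dom (col ?G)"
      then obtain l where "l \<in> dom (col ?G)" "i < l" "l < j"
        using contig[OF True, of j] adj by (auto simp: adjacent_def)
      then show False using adj by (auto simp: adjacent_def P_def)
    qed
    then show ?thesis using s_sim[OF i] adj True by (auto simp: d_def adjacent_def intro: sim_sym)
  next
    case False
    then show ?thesis using monotone_onD[OF s_mono, of i j] adj
      by (auto simp: d_def adjacent_def intro: sim_refl)
  qed
  have T_sim: "sim M (T j - T i) (s j - s i)" if "i \<in> P" "j \<in> P" "i < j" for i j
  proof (rule adjacent_chain[where f = id and S = P and Q = "\<lambda>i j. sim M (T j - T i) (s j - s i)"])
    show "sim M (T w - T u) (s w - s u)"
      if "sim M (T v - T u) (s v - s u)" "sim M (T w - T v) (s w - s v)" for u v w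
      using sim_add[OF that] by simp
  qed (use that d_sim T in auto)
  have "retimed_layout K M (Gs b) (ps b) (ts b) P T" for b
  proof -
    interpret layout K M "Gs b" "ps b" "ts b" by (rule lay)
    show ?thesis
    proof
      show "dom (col (Gs b)) \<subseteq> P" by (auto simp: P_def)
      show "mono_on P T"
      proof (rule mono_onI)
        fix i j assume "i \<in> P" "j \<in> P" "i \<le> j"
        then show "T i \<le> T j" using T_sim[of i j] by (cases "i = j") (auto simp: sim_def)
      qed
      show "T j - T i = stamp (Gs b) (ts b) j - stamp (Gs b) (ts b) i"
        if out: "i \<in> outs (Gs b)" and adj: "adjacent id (dom (col (Gs b))) i j" for i j
      proof -
        have "side i = b" using side out flags_subset by blast
        have "\<not> (i < k \<and> k < j)" if "k \<in> P" for k
        proof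
          assume k: "i < k \<and> k < j"
          then have "k \<notin> dom (col (Gs b))" using adj by (auto simp: adjacent_def)
          then obtain l where "l \<in> dom (col (Gs b))" "i < l" "l < k"
            using contig[OF out, of k] \<open>k \<in> P\<close> k by blast
          then show False using adj k by (auto simp: adjacent_def)
        qed
        then have "adjacent id P i j" using adj by (auto simp: adjacent_def P_def)
        then show ?thesis using T out \<open>side i = b\<close> by (simp add: d_def)
      qed
      show "sim M (T j - T i) (stamp (Gs b) (ts b) j - stamp (Gs b) (ts b) i)"
        if "i \<in> dom (col (Gs b))" "j \<in> dom (col (Gs b))" "i < j" for i j
        using sim_trans[OF T_sim s_sim[OF that]] that by (auto simp: P_def)
    qed (use contig in blast)
  qed
  moreover have "T i mod int M = s i mod int M" if "i \<in> P" for i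
  proof (cases "i = Min P")
    case False
    then have "Min P \<in> P" "Min P < i" using \<open>finite P\<close> that by (auto simp: less_le intro: Min_in)
    then have "(T i - T (Min P)) mod int M = (s i - s (Min P)) mod int M"
      using T_sim[of "Min P" i] that by (simp add: sim_def)
    then show ?thesis using T_Min by (metis diff_add_cancel mod_add_left_eq)
  qed (simp add: T_Min)
  ultimately show ?thesis using T_sim by blast
qed

lemma lex_less_iff:
  fixes a b i j N :: nat
  assumes "a < N" "b < N"
  shows "i * N + a < j * N + b \<longleftrightarrow> i < j \<or> i = j \<and> a < b"
proof -
  have "i * N + a < j * N + b" if "i < j" "a < N" for i j a b :: nat
  proof -
    have "Suc i * N \<le> j * N" using that by (intro mult_right_mono) auto
    then show ?thesis using that by simp
  qed
  from this[of i j a b] this[of j i b a] show ?thesis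
    using assms by (cases i j rule: linorder_cases) auto
qed

text \<open>Vertices are sorted by their last color and then by their old position. Colors are
  disjoint, so vertices of different arguments never tie in the first key;
  \<open>last_color_mono\<close> preserves the old order within an argument. Indexing the arguments
  by \<open>bool\<close> treats both sides at once.\<close>

lemma layout_merge:
  fixes Gs :: "bool \<Rightarrow> 'a cgraph" and U :: "'a cgraph"
  assumes wf: "wf_graph K M U"
    and verts: "verts U = (\<Union>b. Cons b ` verts (Gs b))"
    and succs: "\<And>x y. (x, y) \<in> succs U \<longleftrightarrow> (\<exists>b u v. x = b # u \<and> y = b # v \<and> (u, v) \<in> succs (Gs b))"
    and timed: "\<And>x y I. (x, y) \<in> timed U I \<longleftrightarrow> (\<exists>b u v. x = b # u \<and> y = b # v \<and>
      (u, v) \<in> timed (Gs b) I)"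
    and col: "\<And>k x. col U k = Some x \<longleftrightarrow> (\<exists>b u. x = b # u \<and> col (Gs b) k = Some u)"
    and disj: "dom (col (Gs False)) \<inter> dom (col (Gs True)) = {}"
    and P: "P = (\<Union>b. dom (col (Gs b)))"
    and lay: "\<And>b. retimed_layout K M (Gs b) (ps b) (ts b) P T"
  shows "\<exists>pos t. layout K M U pos t \<and> (\<forall>i\<in>P. stamp U t i = T i)"
proof -
  have lay': "layout K M (Gs b) (ps b) (ts b)" for b
    using lay[of b] by (simp add: retimed_layout_def)
  note wfb = layout.wf[OF lay']
  define c where "c b x = layout.last_color (Gs b) (ps b) x" for b x
  define r where "r b x = retimed_layout.retime (Gs b) (ps b) (ts b) T x" for b x
  have c_dom: "c b x \<in> dom (col (Gs b))" if "x \<in> verts (Gs b)" for b x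
    using retimed_layout.last_color_dom[OF lay that] by (simp add: c_def)
  then have c_P: "c b x \<in> P" if "x \<in> verts (Gs b)" for b x using that P by blast
  have c_mono: "c b x \<le> c b y" if "x \<in> verts (Gs b)" "y \<in> verts (Gs b)" "ps b x \<le> ps b y" for b x y
    using layout.last_color_mono[OF lay' that] by (simp add: c_def)
  have c_side: "b = b'" if "x \<in> verts (Gs b)" "y \<in> verts (Gs b')" "c b x = c b' y" for b b' x y
    using c_dom[OF that(1)] c_dom[OF that(2)] that(3) disj by (cases b; cases b') auto
  have c_col: "c b u = i" if "col (Gs b) i = Some u" for b i u
    using layout.last_color_col[OF lay' that] by (simp add: c_def)
  obtain N where N: "\<And>b x. x \<in> verts (Gs b) \<Longrightarrow> ps b x < N"
  proof -
    have "finite (\<Union>b. ps b ` verts (Gs b))" using wf_graphD(1)[OF wfb] by auto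
    then obtain N where "\<forall>n \<in> (\<Union>b. ps b ` verts (Gs b)). n < N"
      using finite_nat_set_iff_bounded by blast
    then show thesis using that by blast
  qed
  \<comment> \<open>The lexicographic pair written as one number in base \<open>N\<close>, a strict
    bound on all old positions.\<close>
  define pos where "pos w = c (hd w) (tl w) * N + ps (hd w) (tl w)" for w
  define t where "t w = r (hd w) (tl w)" for w
  have pos_less: "pos (b # x) < pos (b' # y) \<longleftrightarrow> c b x < c b' y \<or> c b x = c b' y \<and> ps b x < ps b' y"
    if "x \<in> verts (Gs b)" "y \<in> verts (Gs b')" for b b' x y
    using lex_less_iff[OF N[OF that(1)] N[OF that(2)]] by (simp add: pos_def)
  have pos_side: "pos (b # x) < pos (b # y) \<longleftrightarrow> ps b x < ps b y"
    if "x \<in> verts (Gs b)" "y \<in> verts (Gs b)" for b x y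
    using pos_less[OF that] c_mono[OF that] c_mono[OF that(2,1)] by force
  have "layout K M U pos t"
  proof
    show "inj_on pos (verts U)"
    proof (rule inj_onI)
      fix w w' assume "w \<in> verts U" "w' \<in> verts U" and eq: "pos w = pos w'"
      then obtain b b' x y where w: "w = b # x" "w' = b' # y"
        and x: "x \<in> verts (Gs b)" and y: "y \<in> verts (Gs b')" by (auto simp: verts)
      have "c b x = c b' y" "ps b x = ps b' y"
        using pos_less[OF x y] pos_less[OF y x] eq unfolding w by auto
      moreover from this have "b = b'" using c_side x y by blast
      ultimately show "w = w'"
        using layout.inj_pos[OF lay', of b] x y unfolding w by (auto simp: inj_on_def)
    qed
  next
    fix w w' assume "(w, w') \<in> succs U"
    then obtain b x y where w: "w = b # x" "w' = b # y" and xy: "(x, y) \<in> succs (Gs b)"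
      by (auto simp: succs)
    have adj: "adjacent (ps b) (verts (Gs b)) x y" by (rule layout.succs_adjacent[OF lay' xy])
    then have x: "x \<in> verts (Gs b)" and y: "y \<in> verts (Gs b)" by (auto simp: adjacent_def)
    have "\<not> (pos w < pos (b' # z) \<and> pos (b' # z) < pos w')" if z: "z \<in> verts (Gs b')" for b' z
    proof
      assume between: "pos w < pos (b' # z) \<and> pos (b' # z) < pos w'"
      show False
      proof (cases "b' = b")
        case True
        then show False using between adj z pos_side x y unfolding w by (auto simp: adjacent_def)
      next
        case False
        then have "c b x \<noteq> c b' z" "c b' z \<noteq> c b y" using c_side x y z by blast+
        then have "c b x < c b' z" "c b' z < c b y"
          using between pos_less[OF x z] pos_less[OF z y] unfolding w by auto
        then show False
          using retimed_layout.edge_gap[OF lay xy c_P[OF z]] by (simp add: c_def)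
      qed
    qed
    then show "adjacent pos (verts U) w w'"
      using x y pos_side[OF x y] adj unfolding w by (auto simp: adjacent_def verts)
  next
    fix w assume "w \<in> verts U" "w \<notin> ran (col U)"
    then obtain b x where w: "w = b # x" "x \<in> verts (Gs b)" "x \<notin> ran (col (Gs b))"
      by (auto simp: verts ran_def col)
    then show "w \<in> Domain (succs U) \<and> w \<in> Range (succs U)"
      using layout.uncolored[OF lay', of x b] by (auto simp: Domain_iff Range_iff succs)
  next
    fix i j u v assume "col U i = Some u" "col U j = Some v" "i < j"
    then show "pos u < pos v"
      using wf_graphD(6)[OF wfb] by (auto simp: col pos_less c_col)
  next
    fix w w' assume "w \<in> verts U" "w' \<in> verts U" and le: "pos w \<le> pos w'"
    then obtain b b' x y where w: "w = b # x" "w' = b' # y"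
      and x: "x \<in> verts (Gs b)" and y: "y \<in> verts (Gs b')" by (auto simp: verts)
    show "t w \<le> t w'"
    proof (cases "b = b'")
      case True
      then have "ps b x \<le> ps b y" using le pos_side[of y b x] x y unfolding w by auto
      then show ?thesis
        using retimed_layout.retime_mono[OF lay, of x b y] x y True by (simp add: w t_def r_def)
    next
      case False
      then have "c b x \<noteq> c b' y" using c_side x y by blast
      then have "c b x < c b' y" using le pos_less[OF y x] unfolding w by auto
      then show ?thesis
        using retimed_layout.retime_le[OF lay x c_P[OF y]] retimed_layout.retime_ge[OF lay y]
        by (simp add: w t_def r_def c_def)
    qed
  next
    fix w w' I assume "(w, w') \<in> timed U I"
    then obtain b x y where w: "w = b # x" "w' = b # y" and xy: "(x, y) \<in> timed (Gs b) I"
      by (auto simp: timed)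
    have "x \<in> verts (Gs b)" "y \<in> verts (Gs b)" using wf_graphD(8)[OF wfb xy] by auto
    then show "pos w < pos w' \<and> real_of_int (t w' - t w) \<in> I"
      using layout.timed[OF lay' xy] retimed_layout.retime_timed[OF lay xy]
      by (simp add: w pos_side t_def r_def)
  qed (rule wf)
  moreover have "stamp U t i = T i" if "i \<in> P" for i
  proof -
    obtain b u where u: "col (Gs b) i = Some u" using \<open>i \<in> P\<close> P by blast
    then have "col U i = Some (b # u)" by (simp add: col)
    then show ?thesis using retimed_layout.retime_col[OF lay u] by (simp add: stamp_def t_def r_def)
  qed
  ultimately show ?thesis by blast
qed

text \<open>Rule \<open>oplus\<close> takes unions of flag sets, so a member of \<open>X\<close>
  outside \<open>P\<close> could mark a color of the other argument. The inclusions rule this out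
  and make the sets unique.\<close>

lemma summary_eq_flags:
  assumes eq: "summary M P X Y Z s = summary M P' X' Y' Z' s'" and M: "0 < M"
    and "X \<subseteq> P" "Y \<subseteq> P" "Z \<subseteq> P" "X' \<subseteq> P'" "Y' \<subseteq> P'" "Z' \<subseteq> P'"
  shows "X = X'" "Y = Y'" "Z = Z'"
proof -
  have P: "P' = P" using summary_eqD(1)[OF eq M] by simp
  show "X = X'" using summary_eqD(2)[OF eq M] assms(3,6) unfolding P by blast
  show "Y = Y'" using summary_eqD(3)[OF eq M] assms(4,7) unfolding P by blast
  show "Z = Z'" using summary_eqD(4)[OF eq M] assms(5,8) unfolding P by blast
qed

text \<open>Converse of \<open>reaches_graph_state\<close>: a term and a layout are assembled
  bottom-up along the run. Unary operations keep positions and stamps; only \<open>Oplus\<close> has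
  to construct new ones.\<close>

lemma reaches_stt_ntaD:
  fixes tr :: "'a stt_op ltree"
  assumes "reaches (stt_nta K M) tr q" and M: "0 < M"
  shows "\<exists>\<tau> G pos t. tr = tree_of \<tau> \<and> is_stt K M \<tau> \<and> monotonic \<tau> \<and> sem \<tau> = Some G \<and>
    layout K M G pos t \<and> q = graph_state M G t"
  using assms(1)
proof (induction rule: reaches.induct)
  case (1 f qs q ts)
  define good where "good tr q \<longleftrightarrow> (\<exists>\<tau> G pos t. tr = tree_of \<tau> \<and> is_stt K M \<tau> \<and> monotonic \<tau> \<and>
    sem \<tau> = Some G \<and> layout K M G pos t \<and> q = graph_state M G t)" for tr :: "'a stt_op ltree" and q
  have ts: "list_all2 good ts qs"
    by (rule list.rel_mono_strong[OF 1(2)]) (auto simp: good_def)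
  have "stt_rule K M f qs q" using 1(1) by (simp add: stt_nta_def)
  then have "good (Node f ts) q"
  proof cases
    case (leaf i a s)
    \<comment> \<open>Any position will do, while the stamp must have the residue guessed by the
      rule.\<close>
    have "layout K M (leaf_graph i a) (\<lambda>_. 0) (\<lambda>_. s i)" using leaf by (intro layout_leaf)
    moreover have "q = graph_state M (leaf_graph i a) (\<lambda>_. s i)"
      unfolding leaf graph_state_def
      by (simp add: outs_def ins_def dirs_def, intro summary_eqI) (auto simp: stamp_def)
    moreover have "Node f ts = tree_of (Leaf i a)" using ts leaf by simp
    ultimately show ?thesis unfolding good_def
      using leaf by (intro exI[of _ "Leaf i a"] exI conjI) (auto simp del: atLeastAtMost_iff)
  next
    case (add_succ P s i j X Z Y)
    obtain tr1 where ts1: "ts = [tr1]" and "good tr1 (summary M P X Y Z s)"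
      using ts unfolding add_succ by (auto simp: list_all2_Cons2)
    then obtain \<tau> G pos t where tr1: "tr1 = tree_of \<tau>" and \<tau>: "is_stt K M \<tau>" "monotonic \<tau>"
      "sem \<tau> = Some G"
      and "layout K M G pos t" and st: "summary M P X Y Z s = graph_state M G t"
      unfolding good_def by blast
    interpret layout K M G pos t by fact
    note eq = st[symmetric, unfolded graph_state_def]
    have P: "P = dom (col G)" using summary_eqD(1)[OF eq M] by simp
    note flags = summary_eqD(2-4)[OF eq M, folded P]
    have adj: "adjacent id (dom (col G)) i j" using add_succ P by simp
    then have dom: "i \<in> dom (col G)" "j \<in> dom (col G)" by (auto simp: adjacent_def)
    let ?\<tau> = "AddSucc i j \<tau>"
    have stt: "is_stt K M ?\<tau>" using \<tau> dom add_succ P by auto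
    have mon: "monotonic ?\<tau>"
      using \<tau> adj next_color_eq_iff[OF wf_graphD(4)[OF wf]]
        unfolding monotonic.simps sem_active[OF \<tau>(3)] by blast
    have sem: "sem ?\<tau> = Some (add_succ i j G)" using \<tau> by simp
    have "layout K M (add_succ i j G) pos t"
      using add_succ flags dom P by (intro layout_add_succ wf_sem[OF stt mon sem] adj) blast
    moreover have "q = graph_state M (add_succ i j G) t"
      unfolding graph_state_add_succ[OF wf dom] add_succ P[symmetric]
      by (rule summary_transfer[OF eq[folded P, symmetric] M add_succ(5)])
        (use mono_stamp P flags in auto)
    ultimately show ?thesis unfolding good_def ts1 tr1 add_succ using stt mon sem
      by (intro exI[of _ ?\<tau>] exI conjI) auto
  next
    case (add_time P s I i j X Y Z)
    obtain tr1 where ts1: "ts = [tr1]" and "good tr1 (summary M P X Y Z s)"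
      using ts unfolding add_time by (auto simp: list_all2_Cons2)
    then obtain \<tau> G pos t where tr1: "tr1 = tree_of \<tau>" and \<tau>: "is_stt K M \<tau>" "monotonic \<tau>"
      "sem \<tau> = Some G"
      and "layout K M G pos t" and st: "summary M P X Y Z s = graph_state M G t"
      unfolding good_def by blast
    interpret layout K M G pos t by fact
    note eq = st[symmetric, unfolded graph_state_def]
    have P: "P = dom (col G)" using summary_eqD(1)[OF eq M] by simp
    let ?\<tau> = "AddTime I i j \<tau>"
    have stt: "is_stt K M ?\<tau>" using \<tau> add_time by auto
    have mon: "monotonic ?\<tau>" using \<tau> add_time by simp
    have sem: "sem ?\<tau> = Some (add_time I i j G)" using \<tau> by simp
    have "real_of_int (t v - t u) \<in> I" if u: "col G i = Some u" and v: "col G j = Some v" for u v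
    proof -
      have ij: "i \<in> P" "j \<in> P" using u v P by auto
      \<comment> \<open>The rule tests the interval on its own stamps \<open>s\<close>; similarity
        carries the result over to \<open>t\<close>.\<close>
      have "sim M (s j - s i) (stamp G t j - stamp G t i)"
        by (rule summary_eq_sim[OF eq[folded P, symmetric] M add_time(5)])
          (use mono_stamp P ij add_time in auto)
      then have "s j - s i = t v - t u \<or> int M \<le> s j - s i \<and> int M \<le> t v - t u"
        using u v by (elim sim_cases) (auto simp: stamp_def)
      then show ?thesis by (rule interval_sim[OF add_time(6)]) (use add_time ij in blast)
    qed
    then have "layout K M (add_time I i j G) pos t"
      using add_time by (intro layout_add_time wf_sem[OF stt mon sem])
    moreover have "q = graph_state M (add_time I i j G) t"
      unfolding graph_state_add_time add_time st ..
    ultimately show ?thesis unfolding good_def ts1 tr1 add_time using stt mon sem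
      by (intro exI[of _ ?\<tau>] exI conjI) auto
  next
    case (forget P s i X Y Z)
    obtain tr1 where ts1: "ts = [tr1]" and "good tr1 (summary M P X Y Z s)"
      using ts unfolding forget by (auto simp: list_all2_Cons2)
    then obtain \<tau> G pos t where tr1: "tr1 = tree_of \<tau>" and \<tau>: "is_stt K M \<tau>" "monotonic \<tau>"
      "sem \<tau> = Some G"
      and "layout K M G pos t" and st: "summary M P X Y Z s = graph_state M G t"
      unfolding good_def by blast
    interpret layout K M G pos t by fact
    note eq = st[symmetric, unfolded graph_state_def]
    have P: "P = dom (col G)" using summary_eqD(1)[OF eq M] by simp
    note flags = summary_eqD(2-4)[OF eq M, folded P]
    let ?\<tau> = "Forget i \<tau>"
    have stt: "is_stt K M ?\<tau>" using \<tau> forget by auto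
    have mon: "monotonic ?\<tau>" using \<tau> by simp
    have sem: "sem ?\<tau> = Some (Defs.forget i G)" using \<tau> by simp
    have "layout K M (Defs.forget i G) pos t"
      using forget flags P by (intro layout_forget wf_sem[OF stt mon sem]) blast
    moreover have "q = graph_state M (Defs.forget i G) t"
      unfolding graph_state_forget forget P[symmetric]
      by (rule summary_transfer[OF eq[folded P, symmetric] M forget(5)])
        (use mono_stamp P flags in auto)
    ultimately show ?thesis unfolding good_def ts1 tr1 forget using stt mon sem
      by (intro exI[of _ ?\<tau>] exI conjI) auto
  next
    case (rename P i j X Y Z s)
    obtain tr1 where ts1: "ts = [tr1]" and "good tr1 (summary M P X Y Z s)"
      using ts unfolding rename by (auto simp: list_all2_Cons2)
    then obtain \<tau> G pos t where tr1: "tr1 = tree_of \<tau>" and \<tau>: "is_stt K M \<tau>" "monotonic \<tau>"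
      "sem \<tau> = Some G"
      and "layout K M G pos t" and st: "summary M P X Y Z s = graph_state M G t"
      unfolding good_def by blast
    interpret layout K M G pos t by fact
    have P: "P = dom (col G)" using summary_eqD(1)[OF st[unfolded graph_state_def] M] .
    have ij: "i \<in> dom (col G)" "j \<in> {1..K}"
      "\<forall>k\<in>dom (col G). k < i \<longrightarrow> k < j" "\<forall>k\<in>dom (col G). i < k \<longrightarrow> j < k"
      using rename P by auto
    let ?\<tau> = "Rename i j \<tau>"
    have "i \<in> {1..K}" using wf_graphD(3)[OF wf] ij by blast
    then have stt: "is_stt K M ?\<tau>" and "0 < i" using \<tau> ij by auto
    have "0 < j" using ij by auto
    then have mon: "monotonic ?\<tau>"
      using \<tau> ij rename_condition_iff[OF wf_graphD(4)[OF wf] \<open>0 < i\<close>, of j]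
      unfolding monotonic.simps sem_active[OF \<tau>(3)] by blast
    have sem: "sem ?\<tau> = Some (Defs.rename i j G)" using \<tau> by simp
    have "layout K M (Defs.rename i j G) pos t"
      using layout_rename_iff[OF wf ij] layout_axioms by blast
    moreover have "q = graph_state M (Defs.rename i j G) t"
      unfolding graph_state_rename[OF ij(1,3,4)] rename st ..
    ultimately show ?thesis unfolding good_def ts1 tr1 rename using stt mon sem
      by (intro exI[of _ ?\<tau>] exI conjI) auto
  next
    case (oplus P P' s X Y Z X' Y' Z')
    obtain tr1 tr2 where ts1: "ts = [tr1, tr2]" and tr: "good tr1 (summary M P X Y Z s)"
      "good tr2 (summary M P' X' Y' Z' s)"
      using ts unfolding oplus by (auto simp: list_all2_Cons2)
    from tr(1) obtain \<tau> G ps t where tr1: "tr1 = tree_of \<tau>" and \<tau>: "is_stt K M \<tau>" "monotonic \<tau>"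
      "sem \<tau> = Some G"
      and lay1: "layout K M G ps t" and st1: "summary M P X Y Z s = graph_state M G t"
      unfolding good_def by blast
    from tr(2) obtain \<tau>' G' ps' t' where tr2: "tr2 = tree_of \<tau>'" and \<tau>': "is_stt K M \<tau>'"
      "monotonic \<tau>'" "sem \<tau>' = Some G'"
      and lay2: "layout K M G' ps' t'" and st2: "summary M P' X' Y' Z' s = graph_state M G' t'"
      unfolding good_def by blast
    note eq1 = st1[unfolded graph_state_def] and eq2 = st2[unfolded graph_state_def]
    have P: "P = dom (col G)" "P' = dom (col G')"
      using summary_eqD(1)[OF eq1 M] summary_eqD(1)[OF eq2 M] by auto
    have flags: "outs G = X" "ins G = Y" "dirs G = Z"
      using summary_eq_flags[OF eq1 M oplus(7-9) flags_subset] by simp_all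
    have flags': "outs G' = X'" "ins G' = Y'" "dirs G' = Z'"
      using summary_eq_flags[OF eq2 M oplus(10-12) flags_subset] by simp_all
    let ?\<tau> = "Oplus \<tau> \<tau>'" and ?U = "graph_union G G'"
    have disj: "dom (col G) \<inter> dom (col G') = {}" using oplus P by simp
    have stt: "is_stt K M ?\<tau>" and mon: "monotonic ?\<tau>" and sem: "sem ?\<tau> = Some ?U"
      using \<tau> \<tau>' disj by auto
    define Gs where "Gs b = (if b then G' else G)" for b
    define pss where "pss b = (if b then ps' else ps)" for b
    define tss where "tss b = (if b then t' else t)" for b
    have dom: "(\<Union>b. dom (col (Gs b))) = P \<union> P'" by (auto simp: UNIV_bool Gs_def P)
    have mono: "mono_on P s" "mono_on P' s" using oplus(6) by (auto intro: monotone_on_subset)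
    have lay: "layout K M (Gs b) (pss b) (tss b)" for b
      using lay1 lay2 by (simp add: Gs_def pss_def tss_def)
    have s_sim: "sim M (s j - s i) (stamp (Gs b) (tss b) j - stamp (Gs b) (tss b) i)"
      if "i \<in> dom (col (Gs b))" "j \<in> dom (col (Gs b))" "i < j" for b i j
    proof (cases b)
      case True
      show ?thesis
        using summary_eq_sim[OF eq2[folded P] M mono(2) layout.mono_stamp[OF lay2, folded P]] that
          True
        by (simp add: Gs_def tss_def P)
    next
      case False
      show ?thesis
        using summary_eq_sim[OF eq1[folded P] M mono(1) layout.mono_stamp[OF lay1, folded P]] that
          False
        by (simp add: Gs_def tss_def P)
    qed
    have contig: "\<exists>j \<in> dom (col (Gs b)). i < j \<and> j < k"
      if "i \<in> outs (Gs b)" "k \<in> (P \<union> P') - dom (col (Gs b))" "i < k" for b i k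
      using oplus that flags flags' P unfolding Gs_def by (cases b) (simp_all, blast+)
    obtain T where retimed: "\<And>b. retimed_layout K M (Gs b) (pss b) (tss b) (P \<union> P') T"
      and T: "\<forall>i \<in> P \<union> P'. T i mod int M = s i mod int M"
        "\<forall>i \<in> P \<union> P'. \<forall>j \<in> P \<union> P'. i < j \<longrightarrow> sim M (T j - T i) (s j - s i)"
      using ex_retiming[where Gs = Gs and ps = pss and ts = tss
        and s = s, OF M lay, unfolded dom, OF _ contig oplus(6) s_sim] disj
      by (auto simp: Gs_def)
    have "\<exists>pos t. layout K M ?U pos t \<and> (\<forall>i \<in> P \<union> P'. stamp ?U t i = T i)"
    proof (rule layout_merge[where Gs = Gs and ps = pss and ts = tss])
      show "wf_graph K M ?U" by (rule wf_sem[OF stt mon sem])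
      show "verts ?U = (\<Union>b. Cons b ` verts (Gs b))" by (auto simp: UNIV_bool Gs_def)
      show "(x, y) \<in> succs ?U \<longleftrightarrow> (\<exists>b u v. x = b # u \<and> y = b # v \<and> (u, v) \<in> succs (Gs b))" for x y
        unfolding succs_graph_union ex_bool_eq Gs_def by auto
      show "(x, y) \<in> timed ?U I \<longleftrightarrow> (\<exists>b u v. x = b # u \<and> y = b # v \<and> (u, v) \<in> timed (Gs b) I)"
        for x y I
        unfolding timed_graph_union ex_bool_eq Gs_def by auto
      show "col ?U k = Some x \<longleftrightarrow> (\<exists>b u. x = b # u \<and> col (Gs b) k = Some u)" for k x
        unfolding col_graph_union[OF disj] ex_bool_eq Gs_def by auto
      show "retimed_layout K M (Gs b) (pss b) (tss b) (P \<union> P') T" for b by (rule retimed)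
      show "dom (col (Gs False)) \<inter> dom (col (Gs True)) = {}" using disj by (simp add: Gs_def)
    qed (rule dom[symmetric])
    then obtain pos r where lay: "layout K M ?U pos r" and r: "\<And>i. i \<in> P \<union> P' \<Longrightarrow> stamp ?U r i = T i"
      by blast
    \<comment> \<open>The rule computes \<open>q\<close> from \<open>s\<close>, whereas the merged
      layout has the stamps \<open>T\<close> on the colors; they have equal residues and similar
      distances.\<close>
    have "q = graph_state M ?U r"
      unfolding graph_state_def dom_col_graph_union P[symmetric] flags_graph_union[OF disj] flags
        flags' oplus
      by (rule summary_cong) (use T r sim_sym in auto)
    then show ?thesis unfolding good_def ts1 tr1 tr2 oplus using stt mon sem lay
      by (intro exI[of _ ?\<tau>] exI conjI) auto
  qed
  then show ?case by (simp add: good_def)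
qed

section \<open>Words with timing constraints\<close>

text \<open>Every vertex that is not last has a successor edge: uncolored ones always, colored ones
  because a larger color follows and \<open>colors\<close> applies. So the edges are all
  neighbouring pairs, and reachability is the position order.\<close>

lemma (in layout) final_layout:
  assumes colors: "\<And>i j. \<lbrakk>i \<in> dom (col G); j \<in> dom (col G); i < j\<rbrakk> \<Longrightarrow>
    i \<in> outs G \<and> (\<forall>k \<in> dom (col G). k \<le> j)"
  shows "is_tcw G" "realizable G" "ran (col G) = endpoints G"
proof -
  have adj_succs: "(u, v) \<in> succs G" if adj: "adjacent pos (verts G) u v" for u v
  proof -
    have uv: "u \<in> verts G" "v \<in> verts G" "pos u < pos v" using adj by (auto simp: adjacent_def)
    have "u \<in> Domain (succs G)"
    proof (cases "u \<in> ran (col G)")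
      case True
      then obtain i where i: "col G i = Some u" by (auto simp: ran_def)
      obtain j w where j: "col G j = Some w" "pos v \<le> pos w" using ex_first_color[OF uv(2)] by blast
      then have "i < j" using col_less_iff[OF i j(1)] uv by simp
      then show ?thesis using colors[of i j] i j by (auto simp: outs_def)
    qed (use uncolored uv in blast)
    then obtain w where w: "(u, w) \<in> succs G" by blast
    then show ?thesis using adjacent_unique(1)[OF inj_pos adj succs_adjacent[OF w]] by simp
  qed
  have le: "le_rel G = {(u, v). u \<in> verts G \<and> v \<in> verts G \<and> pos u \<le> pos v}" (is "_ = ?L")
  proof -
    have "pos u \<le> pos v" if "(u, v) \<in> (succs G)\<^sup>*" for u v
      using that by induction (auto dest!: succs_adjacent simp: adjacent_def)
    moreover have "(u, v) \<in> (succs G)\<^sup>*" if uv: "u \<in> verts G" "v \<in> verts G" "pos u \<le> pos v" for u v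
    proof (cases "u = v")
      case False
      then have "pos u < pos v" using uv inj_pos by (auto simp: inj_on_def le_less)
      show ?thesis
        by (rule adjacent_chain[where f = pos and S = "verts G" and Q =
          "\<lambda>u v. (u, v) \<in> (succs G)\<^sup>*",
              OF _ _ uv(1,2) \<open>pos u < pos v\<close>])
          (use adj_succs in \<open>auto intro: rtrancl_trans\<close>)
    qed simp
    ultimately show ?thesis unfolding le_rel_def by auto
  qed
  have less: "(u, v) \<in> less_rel G \<longleftrightarrow> u \<in> verts G \<and> v \<in> verts G \<and> pos u < pos v" for u v
    using inj_pos unfolding less_rel_def le by (auto simp: inj_on_def le_less)
  have "linear_order_on (verts G) (le_rel G)"
    unfolding le linear_order_on_def partial_order_on_def preorder_on_def
    using inj_pos by (auto simp: refl_on_def trans_def antisym_def total_on_def inj_on_def)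
  moreover have "succs G = {(u, v) \<in> less_rel G. \<not> (\<exists>w. (u, w) \<in> less_rel G \<and> (w, v) \<in> less_rel G)}"
  proof -
    have "(u, v) \<in> less_rel G \<and> \<not> (\<exists>w. (u, w) \<in> less_rel G \<and> (w, v) \<in> less_rel G) \<longleftrightarrow>
      adjacent pos (verts G) u v" for u v
      by (auto simp: less adjacent_def)
    then show ?thesis using adj_succs succs_adjacent by auto
  qed
  moreover have "timed G I \<subseteq> less_rel G" for I
    using timed wf_graphD(8)[OF wf] by (auto simp: less)
  ultimately show "is_tcw G" by (simp add: is_tcw_def)
  show "realizable G"
    unfolding realizable_def le
    by (rule exI[of _ "\<lambda>v. real_of_int (t v)"]) (use time_mono timed in auto)
  show "ran (col G) = endpoints G"
  proof
    show "ran (col G) \<subseteq> endpoints G"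
    proof
      fix v assume "v \<in> ran (col G)"
      then obtain i where i: "col G i = Some v" by (auto simp: ran_def)
      note v = wf_graphD(6)[OF wf i]
      \<comment> \<open>A colored point with points on both sides would have a smaller color before
        it and a larger one after it, three colors in all.\<close>
      have "\<not> ((u, v) \<in> less_rel G \<and> (v, w) \<in> less_rel G)" for u w
      proof
        assume "(u, v) \<in> less_rel G \<and> (v, w) \<in> less_rel G"
        then have uw: "u \<in> verts G" "pos u < pos v" "w \<in> verts G" "pos v < pos w"
          by (auto simp: less)
        obtain k x where k: "col G k = Some x" "pos x \<le> pos u" by (rule last_color[OF uw(1)]) blast
        obtain l y where l: "col G l = Some y" "pos w \<le> pos y" using ex_first_color[OF uw(3)]
          by blast
        have "k < i" "i < l" using col_less_iff[OF k(1) i] col_less_iff[OF i l(1)] k l uw by auto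
        then show False using colors[of k i] k(1) i l(1) by force
      qed
      then show "v \<in> endpoints G" using v by (auto simp: endpoints_def)
    qed
    have "v \<in> ran (col G)" if "v \<in> verts G"
      "(\<forall>u. (u, v) \<notin> less_rel G) \<or> (\<forall>u. (v, u) \<notin> less_rel G)" for v
      using uncolored[OF that(1)] that(2) succs_adjacent by (auto simp: less adjacent_def)
    then show "endpoints G \<subseteq> ran (col G)" unfolding endpoints_def by auto
  qed
qed

text \<open>Bounds of the form \<open>y + c \<le> x\<close> and \<open>x \<le> y + d\<close> survive
  rounding down, since the floor is monotone and commutes with adding integers.\<close>

lemma floor_interval:
  assumes "I \<in> intervals M" "x - y \<in> I"
  shows "real_of_int (\<lfloor>x\<rfloor> - \<lfloor>y\<rfloor>) \<in> I"
proof -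
  have lower: "real c \<le> real_of_int (\<lfloor>x\<rfloor> - \<lfloor>y\<rfloor>)" if "real c \<le> x - y" for c
  proof -
    have "\<lfloor>y\<rfloor> + int c \<le> \<lfloor>x\<rfloor>" using that by linarith
    then show ?thesis by linarith
  qed
  have upper: "real_of_int (\<lfloor>x\<rfloor> - \<lfloor>y\<rfloor>) \<le> real d" if "x - y \<le> real d" for d
  proof -
    have "\<lfloor>x\<rfloor> \<le> \<lfloor>y\<rfloor> + int d" using that by linarith
    then show ?thesis by linarith
  qed
  show ?thesis using assms lower upper by (auto simp: intervals_def)
qed

text \<open>Colors follow the word order because \<open>wf_graph\<close> makes them increase along
  paths, and in a TCW any two points are joined by a path. Only endpoints are colored, so an
  uncolored point has points on both sides and hence both neighbours.\<close>

lemma ex_layout: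
  assumes wf: "wf_graph K M G" and tcw: "is_tcw G" and "realizable G" and ran:
    "ran (col G) = endpoints G"
  shows "\<exists>pos t. layout K M G pos t"
    and "\<lbrakk>i \<in> dom (col G); j \<in> dom (col G); i < j\<rbrakk> \<Longrightarrow> i \<in> outs G \<and> (\<forall>k \<in> dom (col G). k \<le> j)"
proof -
  have lin: "linear_order_on (verts G) (le_rel G)" using tcw by (simp add: is_tcw_def)
  have less_verts: "u \<in> verts G \<and> v \<in> verts G" if "(u, v) \<in> less_rel G" for u v
    using that by (auto simp: less_rel_def le_rel_def)
  have total: "(u, v) \<in> less_rel G \<or> (v, u) \<in> less_rel G" if "u \<in> verts G" "v \<in> verts G" "u \<noteq> v"
    for u v
    using lin that by (auto simp: linear_order_on_def total_on_def less_rel_def)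
  have asym: "(v, u) \<notin> less_rel G" if "(u, v) \<in> less_rel G" for u v
    using lin that unfolding linear_order_on_def partial_order_on_def antisym_def less_rel_def
      by blast
  have trans: "(u, w) \<in> less_rel G" if "(u, v) \<in> less_rel G" "(v, w) \<in> less_rel G" for u v w
    using lin asym[OF that(1)] that unfolding linear_order_on_def partial_order_on_def
      preorder_on_def
    by (auto simp: less_rel_def dest: transD)
  \<comment> \<open>The rank of a vertex in the finite total order.\<close>
  define pos where "pos v = card {u. (u, v) \<in> less_rel G}" for v
  have pos_mono: "pos u < pos v" if "(u, v) \<in> less_rel G" for u v
    unfolding pos_def
  proof (rule psubset_card_mono)
    show "finite {x. (x, v) \<in> less_rel G}"
      by (rule finite_subset[OF _ wf_graphD(1)[OF wf]]) (use less_verts in auto)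
    show "{x. (x, u) \<in> less_rel G} \<subset> {x. (x, v) \<in> less_rel G}"
      using that trans[OF _ that] by (auto simp: less_rel_def)
  qed
  have less: "(u, v) \<in> less_rel G \<longleftrightarrow> u \<in> verts G \<and> v \<in> verts G \<and> pos u < pos v" for u v
    using pos_mono[of u v] pos_mono[of v u] total[of u v] less_verts by fastforce
  have succs: "(u, v) \<in> succs G \<longleftrightarrow> adjacent pos (verts G) u v" for u v
  proof -
    have "(u, v) \<in> succs G \<longleftrightarrow> (u, v) \<in> less_rel G \<and> \<not> (\<exists>w. (u, w) \<in> less_rel G \<and>
      (w, v) \<in> less_rel G)"
      using tcw unfolding is_tcw_def by blast
    then show ?thesis by (auto simp: less adjacent_def)
  qed
  have col_less: "(u, v) \<in> less_rel G" if col: "col G i = Some u" "col G j = Some v" and "i < j"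
    for i j u v
  proof (rule ccontr)
    assume "(u, v) \<notin> less_rel G"
    moreover have "u \<noteq> v" using col \<open>i < j\<close> wf_graphD(11)[OF wf] by blast
    ultimately have "(v, u) \<in> less_rel G" using total wf_graphD(6)[OF wf] col by blast
    then have "(v, u) \<in> (succs G)\<^sup>+" using \<open>u \<noteq> v\<close>
      by (auto simp: less_rel_def le_rel_def dest: rtranclD)
    then show False using wf_graphD(10)[OF wf col(2,1)] \<open>i < j\<close> by simp
  qed
  obtain t :: "vertex \<Rightarrow> real" where t_mono: "\<And>u v. (u, v) \<in> le_rel G \<Longrightarrow> t u \<le> t v"
    and t_timed: "\<And>I u v. (u, v) \<in> timed G I \<Longrightarrow> t v - t u \<in> I"
    using \<open>realizable G\<close> unfolding realizable_def by blast
  have "layout K M G pos (\<lambda>v. \<lfloor>t v\<rfloor>)"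
  proof
    show "inj_on pos (verts G)"
      using total pos_mono by (intro inj_onI) (metis less_irrefl)
    show "adjacent pos (verts G) u v" if "(u, v) \<in> succs G" for u v using that succs by blast
    show "v \<in> Domain (succs G) \<and> v \<in> Range (succs G)" if v: "v \<in> verts G" "v \<notin> ran (col G)" for v
    proof -
      obtain u w where "(u, v) \<in> less_rel G" "(v, w) \<in> less_rel G"
        using v unfolding ran endpoints_def by blast
      then have "u \<in> verts G" "pos u < pos v" "w \<in> verts G" "pos v < pos w" by (auto simp: less)
      then obtain x y where "adjacent pos (verts G) x v" "adjacent pos (verts G) v y"
        using adjacent_prev[OF \<open>u \<in> verts G\<close> v(1)] adjacent_next[OF v(1) \<open>w \<in> verts G\<close>] by metis
      then show ?thesis using succs by blast
    qed
    show "pos u < pos v" if "col G i = Some u" "col G j = Some v" "i < j" for i j u v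
      using col_less[OF that] pos_mono by blast
    show "\<lfloor>t u\<rfloor> \<le> \<lfloor>t v\<rfloor>" if uv: "u \<in> verts G" "v \<in> verts G" "pos u \<le> pos v" for u v
    proof -
      have "(v, u) \<notin> less_rel G" using uv by (simp add: less)
      then have "u = v \<or> (u, v) \<in> le_rel G" using total uv unfolding less_rel_def by blast
      then show ?thesis using t_mono by (auto intro: floor_mono)
    qed
    show "pos u < pos v \<and> real_of_int (\<lfloor>t v\<rfloor> - \<lfloor>t u\<rfloor>) \<in> I" if uv: "(u, v) \<in> timed G I" for u v I
    proof -
      have "(u, v) \<in> less_rel G" using uv tcw unfolding is_tcw_def by blast
      then show ?thesis using pos_mono floor_interval[OF wf_graphD(9)[OF wf uv] t_timed[OF uv]]
        by blast
    qed
  qed (rule wf)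
  then show "\<exists>pos t. layout K M G pos t" by blast
  assume "i \<in> dom (col G)" "j \<in> dom (col G)" "i < j"
  then obtain u v where u: "col G i = Some u" and v: "col G j = Some v" and uv:
    "(u, v) \<in> less_rel G"
    using col_less by blast
  then obtain w where "adjacent pos (verts G) u w"
    using adjacent_next[of u "verts G" v pos] by (auto simp: less)
  then have "i \<in> outs G" using u succs by (auto simp: outs_def)
  \<comment> \<open>A larger color would put \<open>v\<close> strictly between two points, although
    it is colored and thus an endpoint.\<close>
  moreover have "k \<le> j" if "k \<in> dom (col G)" for k
  proof (rule ccontr)
    assume "\<not> k \<le> j"
    obtain w where "col G k = Some w" using \<open>k \<in> dom (col G)\<close> by blast
    then have "(v, w) \<in> less_rel G" using col_less[OF v] \<open>\<not> k \<le> j\<close> by simp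
    moreover have "v \<in> endpoints G" using v ran by (auto intro: ranI)
    ultimately show False using uv by (auto simp: endpoints_def)
  qed
  ultimately show "i \<in> outs G \<and> (\<forall>k \<in> dom (col G). k \<le> j)" by blast
qed

section \<open>Counting states\<close>

lemma card_stt_states:
  assumes "2 \<le> M"
  shows "finite (stt_states K M)" "card (stt_states K M) \<le> M ^ (6 * K)"
proof -
  let ?V = "(UNIV :: (bool \<times> bool \<times> bool) set) \<times> {..<M} \<times> (UNIV :: bool set)"
  let ?B = "insert None (Some ` ?V)"
  let ?F = "{1..K} \<rightarrow>\<^sub>E ?B"
  \<comment> \<open>Extensional functions are \<open>undefined\<close> outside \<open>{1..K}\<close>
    whereas states are \<open>None\<close> there; restriction converts one convention into the other
    and is injective on states.\<close>
  define r :: "state \<Rightarrow> state" where "r q = restrict q {1..K}" for q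
  have "card (UNIV :: (bool \<times> bool \<times> bool) set) = 8"
    by (simp flip: UNIV_Times_UNIV add: card_cartesian_product)
  then have "card ?V = 16 * M" by (simp add: card_cartesian_product)
  then have card_B: "card ?B = 1 + 16 * M" by (subst card_insert_disjoint) (auto simp: card_image)
  have r_in: "r q \<in> ?F" if q: "q \<in> stt_states K M" for q
    unfolding r_def
  proof (intro restrict_PiE_iff[THEN iffD2] ballI)
    fix i
    show "q i \<in> ?B"
    proof (cases "q i")
      case (Some v)
      then have "v \<in> ?V" using q ranI[of q i v] unfolding stt_states_def by blast
      then show ?thesis using Some by blast
    qed simp
  qed
  have inj: "inj_on r (stt_states K M)"
  proof (intro inj_onI ext)
    fix q q' i assume q: "q \<in> stt_states K M" "q' \<in> stt_states K M" and "r q = r q'"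
    show "q i = q' i"
    proof (cases "i \<in> {1..K}")
      case True
      then show ?thesis using fun_cong[OF \<open>r q = r q'\<close>, of i] by (simp add: r_def)
    next
      case False
      then have "q i = None" "q' i = None" using q unfolding stt_states_def by blast+
      then show ?thesis by simp
    qed
  qed
  have sub: "r ` stt_states K M \<subseteq> ?F" by (rule image_subsetI) (rule r_in)
  have fin: "finite ?F" by (intro finite_PiE) auto
  show "finite (stt_states K M)"
    by (rule inj_on_finite[OF inj sub fin])
  have "card (stt_states K M) \<le> card ?F"
    by (rule card_inj_on_le[OF inj sub fin])
  also have "\<dots> = (1 + 16 * M) ^ K" by (simp add: card_PiE card_B)
  also have "\<dots> \<le> (M ^ 6) ^ K"
  proof (rule power_mono)
    \<comment> \<open>A color has \<open>1 + 16 * M\<close> possible values: inactive, or 8 edge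
      flag triples, \<open>M\<close> residues and 2 values of the last flag. The exponent 6 is
      forced by \<open>M = 2\<close>, where 33 exceeds the fifth power of 2.\<close>
    have "32 * M \<le> M ^ 5 * M" using power_mono[OF assms, of 5] by (intro mult_right_mono) auto
    then show "1 + 16 * M \<le> M ^ 6" using assms by (simp add: eval_nat_numeral mult.commute)
  qed simp
  finally show "card (stt_states K M) \<le> M ^ (6 * K)" by (simp add: power_mult)
qed

lemma summary_in_stt_states: "P \<subseteq> {1..K} \<Longrightarrow> 0 < M \<Longrightarrow> summary M P X Y Z s \<in> stt_states K M"
  by (auto simp: stt_states_def ran_def summary_def nat_less_iff split: if_splits)

lemma stt_rule_wf:
  assumes "stt_rule K M f qs q" "0 < M"
  shows "f \<in> stt_ops K M \<and> length qs = op_rank f \<and> set qs \<subseteq> stt_states K M \<and> q \<in> stt_states K M"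
proof -
  note in_states = summary_in_stt_states[OF _ assms(2)]
  show ?thesis using assms(1)
  proof cases
    case (leaf i a s)
    then show ?thesis unfolding leaf by (auto simp: stt_ops_def intro!: in_states)
  next
    case (add_succ P s i j X Z Y)
    then have "i \<in> {1..K}" "j \<in> {1..K}" by (auto simp: adjacent_def)
    then show ?thesis unfolding add_succ(1-3) using in_states[OF add_succ(4)]
      by (simp add: stt_ops_def)
  next
    case (add_time P s I i j X Y Z)
    then show ?thesis unfolding add_time(1-3) using in_states[OF add_time(4)]
      by (simp add: stt_ops_def)
  next
    case (forget P s i X Y Z)
    then have "P - {i} \<subseteq> {1..K}" by blast
    then show ?thesis unfolding forget(1-3) using in_states[OF forget(4)] in_states forget(6)
      by (simp add: stt_ops_def)
  next
    case (rename P i j X Y Z s)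
    then have "i \<in> {1..K}" by blast
    have "k \<in> {1..K}" if "swap_color i j k \<in> P" for k
      using that rename(4,6) \<open>i \<in> {1..K}\<close> unfolding swap_color_def by (metis subsetD)
    then have "q \<in> stt_states K M"
      unfolding rename(3) summary_swap_color[OF rename(5,7,8)] by (intro in_states) blast
    then show ?thesis
      unfolding rename(1,2) using in_states[OF rename(4)] \<open>i \<in> {1..K}\<close> rename(6)
        by (simp add: stt_ops_def)
  next
    case (oplus P P' s X Y Z X' Y' Z')
    then have "P \<subseteq> {1..K}" "P' \<subseteq> {1..K}" by auto
    then show ?thesis unfolding oplus(1-3) using in_states oplus(4) by (simp add: stt_ops_def)
  qed
qed

lemma finite_stt_ops: "finite (stt_ops K M :: 'a :: finite stt_op set)"
proof -
  have "intervals M = (\<lambda>(c, d). {real c..real d}) ` ({..<M} \<times> {..<M}) \<union> (\<lambda>c. {real c..}) ` {..<M}"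
    by (auto simp: intervals_def)
  then have "finite (intervals M)" by simp
  then have "finite ((\<Union>i\<in>{1..K}. range (LeafOp i)) \<union> (\<Union>i\<in>{1..K}. AddSuccOp i ` {1..K}) \<union>
     (\<Union>I\<in>intervals M. \<Union>i\<in>{1..K}. AddTimeOp I i ` {1..K}) \<union>
     ForgetOp ` {1..K} \<union> (\<Union>i\<in>{1..K}. RenameOp i ` {1..K}) \<union> {OplusOp :: 'a stt_op})"
    by (intro finite_UnI finite_UN_I finite_imageI) simp_all
  then show ?thesis
    by (rule rev_finite_subset) (unfold stt_ops_def, intro Un_mono, blast+)
qed

lemma final_stt_nta:
  "q \<in> final (stt_nta K M) \<longleftrightarrow> (\<exists>P X Y Z s. q = summary M P X Y Z s \<and> P \<subseteq> {1..K} \<and>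
     (\<forall>i\<in>P. \<forall>j\<in>P. i < j \<longrightarrow> i \<in> X \<and> (\<forall>k\<in>P. k \<le> j)))"
  unfolding stt_nta_def by simp

lemma tree_automaton_stt_nta:
  assumes "2 \<le> M"
  shows "tree_automaton (stt_ops K M) op_rank (stt_nta K M :: ('a :: finite stt_op, state) nta)"
proof -
  have M: "0 < M" using assms by simp
  let ?A = "stt_nta K M :: ('a stt_op, state) nta"
  have "final ?A \<subseteq> stt_states K M"
  proof
    fix q assume "q \<in> final ?A"
    then obtain P X Y Z s where "q = summary M P X Y Z s" "P \<subseteq> {1..K}"
      unfolding final_stt_nta by blast
    then show "q \<in> stt_states K M" using summary_in_stt_states[OF _ M] by simp
  qed
  moreover have "states ?A = stt_states K M" "rules ?A = {(f, qs, q). stt_rule K M f qs q}"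
    by (simp_all add: stt_nta_def)
  ultimately show ?thesis
    unfolding tree_automaton_def
    by (auto simp: finite_stt_ops card_stt_states(1)[OF assms] dest: stt_rule_wf[OF _ M])
qed

lemma lang_stt_nta:
  assumes "2 \<le> M"
  shows "lang (stt_nta K M :: ('a stt_op, state) nta) = tree_of ` {\<tau>. is_stt K M \<tau> \<and> monotonic \<tau> \<and>
    (\<exists>G. sem \<tau> = Some G \<and> is_tcw G \<and> realizable G \<and> ran (col G) = endpoints G)}"
    (is "_ = tree_of ` ?S")
proof
  have M: "0 < M" using assms by simp
  show "lang (stt_nta K M) \<subseteq> tree_of ` ?S"
  proof
    fix tr :: "'a stt_op ltree" assume "tr \<in> lang (stt_nta K M)"
    then obtain q where fin: "q \<in> final (stt_nta K M :: ('a stt_op, state) nta)"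
      and reach: "reaches (stt_nta K M) tr q"
      unfolding lang_def by blast
    from reaches_stt_ntaD[OF reach M]
    obtain \<tau> G pos t where \<tau>: "tr = tree_of \<tau>" "is_stt K M \<tau>" "monotonic \<tau>" "sem \<tau> = Some G"
      and "layout K M G pos t" and q: "q = graph_state M G t" by blast
    from fin obtain P X Y Z s where st: "graph_state M G t = summary M P X Y Z s"
      and P: "\<forall>i\<in>P. \<forall>j\<in>P. i < j \<longrightarrow> i \<in> X \<and> (\<forall>k\<in>P. k \<le> j)"
      unfolding final_stt_nta q by blast
    interpret layout K M G pos t by fact
    note eq = st[unfolded graph_state_def]
    have "dom (col G) = P" by (rule summary_eqD(1)[OF eq M])
    then have "i \<in> outs G \<and> (\<forall>k \<in> dom (col G). k \<le> j)"
      if "i \<in> dom (col G)" "j \<in> dom (col G)" "i < j" for i j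
      using P summary_eqD(2)[OF eq M that(1)] that by blast
    note final_layout[OF this]
    then show "tr \<in> tree_of ` ?S" using \<tau> by blast
  qed
  show "tree_of ` ?S \<subseteq> lang (stt_nta K M)"
  proof
    fix tr :: "'a stt_op ltree" assume "tr \<in> tree_of ` ?S"
    then obtain \<tau> G where tr: "tr = tree_of \<tau>" and \<tau>: "is_stt K M \<tau>" "monotonic \<tau>" "sem \<tau> = Some G"
      and G: "is_tcw G" "realizable G" "ran (col G) = endpoints G" by blast
    note wf = wf_sem[OF \<tau>]
    obtain pos t where lay: "layout K M G pos t" using ex_layout(1)[OF wf G] by blast
    have "\<forall>i\<in>dom (col G). \<forall>j\<in>dom (col G). i < j \<longrightarrow> i \<in> outs G \<and> (\<forall>k\<in>dom (col G). k \<le> j)"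
      using ex_layout(2)[OF wf G] by simp
    then have "graph_state M G t \<in> final (stt_nta K M :: ('a stt_op, state) nta)"
      using wf_graphD(3)[OF wf] unfolding final_stt_nta graph_state_def by blast
    then show "tr \<in> lang (stt_nta K M)"
      using reaches_graph_state[OF \<tau> lay] unfolding lang_def tr by blast
  qed
qed

section \<open>Passing from states that are functions to states that are natural numbers\<close>

definition map_states :: "('q \<Rightarrow> 'r) \<Rightarrow> ('f, 'q) nta \<Rightarrow> ('f, 'r) nta" where
  "map_states e A = \<lparr>states = e ` states A, final = e ` final A,
     rules = (\<lambda>(f, qs, q). (f, map e qs, e q)) ` rules A\<rparr>"

lemma tree_automaton_map_states:
  assumes A: "tree_automaton F rk A"
  shows "tree_automaton F rk (map_states e A)"
proof -
  have "f \<in> F \<and> length qs = rk f \<and> (\<forall>p \<in> set qs. p \<in> states A) \<and> q \<in> states A"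
    if "(f, qs, q) \<in> rules A" for f qs q
    using A that unfolding tree_automaton_def by fastforce
  then have "\<forall>(f, qs, q) \<in> rules (map_states e A). f \<in> F \<and> length qs = rk f \<and>
      set qs \<subseteq> states (map_states e A) \<and> q \<in> states (map_states e A)"
    by (auto simp: map_states_def)
  then show ?thesis
    using A by (auto simp: tree_automaton_def map_states_def)
qed

lemma reaches_map_states: "reaches A t q \<Longrightarrow> reaches (map_states e A) t (e q)"
proof (induction rule: reaches.induct)
  case (1 f qs q ts)
  have "(f, map e qs, e q) \<in> rules (map_states e A)"
    using 1(1) by (force simp: map_states_def)
  moreover have "list_all2 (reaches (map_states e A)) ts (map e qs)"
    unfolding list.rel_map by (rule list.rel_mono_strong[OF 1(2)]) simp
  ultimately show ?case by (rule reaches.intros)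
qed

text \<open>Since \<open>e\<close> is injective only on \<open>states A\<close>, the claim records
  that the preimage lies there; the states on the left of a rule do too, so the preimages for the
  children match them.\<close>

lemma reaches_map_statesD:
  assumes A: "tree_automaton F rk A" and inj: "inj_on e (states A)"
    and "reaches (map_states e A) t p"
  shows "\<exists>q \<in> states A. p = e q \<and> reaches A t q"
  using assms(3)
proof (induction rule: reaches.induct)
  case (1 f ps p ts)
  then obtain qs q where rule: "(f, qs, q) \<in> rules A" and ps: "ps = map e qs" "p = e q"
    by (auto simp: map_states_def)
  have st: "set qs \<subseteq> states A" "q \<in> states A" using A rule by (auto simp: tree_automaton_def)
  have "list_all2 (reaches A) ts qs"
    using 1(2)[unfolded ps list.rel_map]
  proof (rule list.rel_mono_strong)
    fix t q' assume "q' \<in> set qs"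
      "reaches (map_states e A) t (e q') \<and> (\<exists>q\<in>states A. e q' = e q \<and> reaches A t q)"
    then show "reaches A t q'" using st(1) inj by (metis inj_onD subsetD)
  qed
  then show ?case using reaches.intros[OF rule] st(2) ps(2) by blast
qed

lemma lang_map_states:
  assumes A: "tree_automaton F rk A" and inj: "inj_on e (states A)"
  shows "lang (map_states e A) = lang A"
proof
  have final: "final (map_states e A) = e ` final A" "final A \<subseteq> states A"
    using A by (auto simp: map_states_def tree_automaton_def)
  show "lang (map_states e A) \<subseteq> lang A"
  proof
    fix t assume "t \<in> lang (map_states e A)"
    then obtain q' where q': "q' \<in> final A" "reaches (map_states e A) t (e q')"
      unfolding lang_def final by blast
    then obtain q where "q \<in> states A" "e q' = e q" "reaches A t q"
      using reaches_map_statesD[OF A inj] by blast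
    moreover from this have "q = q'" using q'(1) final(2) inj by (metis inj_onD subsetD)
    ultimately show "t \<in> lang A" using q'(1) by (auto simp: lang_def)
  qed
  show "lang A \<subseteq> lang (map_states e A)"
  proof
    fix t assume "t \<in> lang A"
    then obtain q where "q \<in> final A" "reaches A t q" by (auto simp: lang_def)
    then show "t \<in> lang (map_states e A)"
      using reaches_map_states[of A t q e] unfolding lang_def final by blast
  qed
qed

theorem theorem4p2:
  "\<exists>C :: nat. \<forall>K \<ge> 2. \<forall>M \<ge> 2. \<exists>A :: ('a :: finite stt_op, nat) nta.
     tree_automaton (stt_ops K M) op_rank A \<and>
     card (states A) \<le> M ^ (C * K) \<and>
     lang A = tree_of ` {\<tau>. is_stt K M \<tau> \<and> monotonic \<tau> \<and>
       (\<exists>G. sem \<tau> = Some G \<and> is_tcw G \<and> realizable G \<and> ran (col G) = endpoints G)}"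
proof (intro exI[of _ 6] allI impI)
  fix K M :: nat assume "2 \<le> M"
  let ?A = "stt_nta K M :: ('a stt_op, state) nta"
  note A = tree_automaton_stt_nta[OF \<open>2 \<le> M\<close>, of K, where 'a = 'a]
  have states: "states ?A = stt_states K M" by (simp add: stt_nta_def)
  note card = card_stt_states[OF \<open>2 \<le> M\<close>, of K]
  obtain e :: "state \<Rightarrow> nat" where inj: "inj_on e (states ?A)"
    using finite_imp_inj_to_nat_seg[OF card(1)] unfolding states by blast
  have "card (states (map_states e ?A)) = card (states ?A)"
    using card_image[OF inj] by (simp add: map_states_def)
  then have le: "card (states (map_states e ?A)) \<le> M ^ (6 * K)" using card(2) states by simp
  show "\<exists>A :: ('a stt_op, nat) nta. tree_automaton (stt_ops K M) op_rank A \<and>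
     card (states A) \<le> M ^ (6 * K) \<and>
     lang A = tree_of ` {\<tau>. is_stt K M \<tau> \<and> monotonic \<tau> \<and>
       (\<exists>G. sem \<tau> = Some G \<and> is_tcw G \<and> realizable G \<and> ran (col G) = endpoints G)}"
  proof (rule exI[of _ "map_states e ?A"], intro conjI)
    show "lang (map_states e ?A) = tree_of ` {\<tau>. is_stt K M \<tau> \<and> monotonic \<tau> \<and>
       (\<exists>G. sem \<tau> = Some G \<and> is_tcw G \<and> realizable G \<and> ran (col G) = endpoints G)}"
      unfolding lang_map_states[OF A inj] by (rule lang_stt_nta[OF \<open>2 \<le> M\<close>])
  qed (rule tree_automaton_map_states[OF A] le)+
qed

end
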